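(* Let $K$ be a field, $S=K[X_1,\dots,X_n]$ the standard graded polynomial ring, $\mathfrak m=(X_1,\dots,X_n)$, and $c\ge1$ an integer. Then $$(c+1)!\,\mathfrak m^{c-1}Z_1(\mathfrak m^c)^c\subset B_c(\mathfrak m^c).$$
   Context: $K(\mathfrak m^c)$ is the Koszul complex over $S$ associated to the set of monomials of degree $c$ in $S$; it is the exterior algebra $S\otimes_K\bigwedge^{\bullet}S_c$ with differential $\partial$ the $S$-linear antiderivation of degree $-1$ sending $1\otimes f$ to $f$ for $f\in S_c$. $Z_t(\mathfrak m^c)$ and $B_t(\mathfrak m^c)$ are the $S$-modules of cycles and boundaries in homological degree $t$. $Z_1(\mathfrak m^c)^t$ denotes the $S$-submodule of $Z_t(\mathfrak m^c)$ generated by all products $z_1\wedge\cdots\wedge z_t$ (in the exterior algebra) of elements $z_i\in Z_1(\mathfrak m^c)$. *)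

theory Defs
  imports Complex_Main "HOL-Library.Poly_Mapping"
begin

text \<open>
  The exterior algebra of the free module on a linearly ordered set of generators
  is modelled on its standard basis: the finite set \<open>A = {a\<^sub>1 < \<dots> < a\<^sub>t}\<close> stands for
  \<open>e\<^sub>A = a\<^sub>1 \<and> \<dots> \<and> a\<^sub>t\<close>, and an element is the finitely supported function of its
  coefficients. The linear order only fixes the signs of the basis vectors.
\<close>

type_synonym ('g, 'r) ext = "'g set \<Rightarrow>\<^sub>0 'r"

definition ext_scale :: "'r::comm_ring_1 \<Rightarrow> ('g, 'r) ext \<Rightarrow> ('g, 'r) ext" where
  "ext_scale r x = Poly_Mapping.map ((*) r) x"

text \<open>\<open>e\<^sub>A \<and> e\<^sub>B = ext_sign A B \<cdot> e\<^bsub>A \<union> B\<^esub>\<close> for disjoint \<open>A\<close> and \<open>B\<close>: the exponent counts inversions.\<close>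

definition ext_sign :: "'g::linorder set \<Rightarrow> 'g set \<Rightarrow> 'r::comm_ring_1" where
  "ext_sign A B = (-1) ^ card {(a, b). a \<in> A \<and> b \<in> B \<and> b < a}"

definition wedge :: "('g::linorder, 'r::comm_ring_1) ext \<Rightarrow> ('g, 'r) ext \<Rightarrow> ('g, 'r) ext" where
  "wedge x y = (\<Sum>A\<in>Poly_Mapping.keys x. \<Sum>B\<in>Poly_Mapping.keys y.
     if A \<inter> B = {} then Poly_Mapping.single (A \<union> B) (ext_sign A B * (Poly_Mapping.lookup x A * Poly_Mapping.lookup y B)) else 0)"

definition wedge_list :: "('g::linorder, 'r::comm_ring_1) ext list \<Rightarrow> ('g, 'r) ext" where
  "wedge_list xs = List.foldr wedge xs (Poly_Mapping.single {} 1)"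

definition ext_power :: "'g set \<Rightarrow> nat \<Rightarrow> ('g, 'r::comm_ring_1) ext set" where
  "ext_power G t = {x. \<forall>A\<in>Poly_Mapping.keys x. finite A \<and> A \<subseteq> G \<and> card A = t}"

text \<open>
  The Koszul differential of the family \<open>(f g)\<^sub>g\<close>. The lemmas \<open>koszul_d_add\<close>, \<open>koszul_d_scale\<close>,
  \<open>koszul_d_generator\<close> and \<open>koszul_d_wedge\<close> below show that it is the linear antiderivation
  of degree \<open>-1\<close> sending each generator \<open>g\<close> to \<open>f g\<close>.
\<close>

definition koszul_d :: "('g::linorder \<Rightarrow> 'r::comm_ring_1) \<Rightarrow> ('g, 'r) ext \<Rightarrow> ('g, 'r) ext" where
  "koszul_d f x = (\<Sum>A\<in>Poly_Mapping.keys x. \<Sum>a\<in>A.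
     Poly_Mapping.single (A - {a}) ((-1) ^ card {b \<in> A. b < a} * (f a * Poly_Mapping.lookup x A)))"


subsection \<open>The model is the exterior algebra with its antiderivation\<close>

lemma lookup_ext_scale [simp]: "Poly_Mapping.lookup (ext_scale r x) A = r * Poly_Mapping.lookup x A"
  unfolding ext_scale_def by transfer (auto simp: when_def)

global_interpretation ext: module "ext_scale :: 'r::comm_ring_1 \<Rightarrow> ('g, 'r) ext \<Rightarrow> ('g, 'r) ext"
  by unfold_locales (auto intro!: poly_mapping_eqI simp: lookup_add algebra_simps)

lemma ext_scale_single [simp]: "ext_scale r (Poly_Mapping.single A s) = Poly_Mapping.single A (r * s)"
  by (rule poly_mapping_eqI) (simp add: lookup_single when_def)

lemma ext_expand: "x = (\<Sum>A\<in>Poly_Mapping.keys x. Poly_Mapping.single A (Poly_Mapping.lookup x A))"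
  by (rule poly_mapping_eqI)
     (auto simp: lookup_sum lookup_single when_def in_keys_iff)

lemma wedge_superset:
  assumes "finite S" "Poly_Mapping.keys x \<subseteq> S" "finite T" "Poly_Mapping.keys y \<subseteq> T"
  shows "wedge x y = (\<Sum>A\<in>S. \<Sum>B\<in>T.
     if A \<inter> B = {} then Poly_Mapping.single (A \<union> B) (ext_sign A B * (Poly_Mapping.lookup x A * Poly_Mapping.lookup y B)) else 0)"
proof -
  have "wedge x y = (\<Sum>A\<in>Poly_Mapping.keys x. \<Sum>B\<in>T.
     if A \<inter> B = {} then Poly_Mapping.single (A \<union> B) (ext_sign A B * (Poly_Mapping.lookup x A * Poly_Mapping.lookup y B)) else 0)"
    unfolding wedge_def using assms
    by (intro sum.cong refl sum.mono_neutral_left) (auto simp: in_keys_iff)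
  also have "\<dots> = (\<Sum>A\<in>S. \<Sum>B\<in>T.
     if A \<inter> B = {} then Poly_Mapping.single (A \<union> B) (ext_sign A B * (Poly_Mapping.lookup x A * Poly_Mapping.lookup y B)) else 0)"
    using assms by (intro sum.mono_neutral_left ballI sum.neutral) (auto simp: in_keys_iff)
  finally show ?thesis .
qed

lemma wedge_single:
  "wedge (Poly_Mapping.single A r) (Poly_Mapping.single B s) =
     (if A \<inter> B = {} then Poly_Mapping.single (A \<union> B) (ext_sign A B * (r * s)) else 0)"
  by (subst wedge_superset[of "{A}" _ "{B}"]) auto

lemma wedge_add_left: "wedge (x + y) z = wedge x z + wedge y z"
proof -
  let ?S = "Poly_Mapping.keys x \<union> Poly_Mapping.keys y"
  show ?thesis
    using keys_add[of x y]
    by (subst (1 2 3) wedge_superset[of ?S _ "Poly_Mapping.keys z"])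
       (auto simp: sum.distrib[symmetric] lookup_add single_add[symmetric] algebra_simps intro!: sum.cong)
qed

lemma wedge_add_right: "wedge z (x + y) = wedge z x + wedge z y"
proof -
  let ?S = "Poly_Mapping.keys x \<union> Poly_Mapping.keys y"
  show ?thesis
    using keys_add[of x y]
    by (subst (1 2 3) wedge_superset[of "Poly_Mapping.keys z" _ ?S])
       (auto simp: sum.distrib[symmetric] lookup_add single_add[symmetric] algebra_simps intro!: sum.cong)
qed

lemma wedge_zero [simp]: "wedge 0 x = 0" "wedge x 0 = 0"
  by (simp_all add: wedge_def)

lemma wedge_sum_left: "wedge (sum h I) z = (\<Sum>i\<in>I. wedge (h i) z)"
  by (induction I rule: infinite_finite_induct) (simp_all add: wedge_add_left)

lemma wedge_sum_right: "wedge z (sum h I) = (\<Sum>i\<in>I. wedge z (h i))"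
  by (induction I rule: infinite_finite_induct) (simp_all add: wedge_add_right)

lemma wedge_expand:
  "wedge x y = (\<Sum>A\<in>Poly_Mapping.keys x. \<Sum>B\<in>Poly_Mapping.keys y. wedge (Poly_Mapping.single A (Poly_Mapping.lookup x A)) (Poly_Mapping.single B (Poly_Mapping.lookup y B)))"
  by (subst wedge_def) (simp add: wedge_single)

lemma wedge_scale_left: "wedge (ext_scale r x) y = ext_scale r (wedge x y)"
proof -
  have "Poly_Mapping.keys (ext_scale r x) \<subseteq> Poly_Mapping.keys x" by (auto simp: in_keys_iff)
  then show ?thesis
    by (subst (1 2) wedge_superset[of "Poly_Mapping.keys x" _ "Poly_Mapping.keys y"])
       (auto simp: ext.scale_sum_right algebra_simps intro!: sum.cong)
qed

lemma wedge_scale_right: "wedge x (ext_scale r y) = ext_scale r (wedge x y)"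
proof -
  have "Poly_Mapping.keys (ext_scale r y) \<subseteq> Poly_Mapping.keys y" by (auto simp: in_keys_iff)
  then show ?thesis
    by (subst (1 2) wedge_superset[of "Poly_Mapping.keys x" _ "Poly_Mapping.keys y"])
       (auto simp: ext.scale_sum_right algebra_simps intro!: sum.cong)
qed

lemma wedge_one_left [simp]: "wedge (Poly_Mapping.single {} 1) x = x"
proof -
  have "wedge (Poly_Mapping.single {} 1) x = (\<Sum>A\<in>Poly_Mapping.keys x. Poly_Mapping.single A (Poly_Mapping.lookup x A))"
    by (subst wedge_expand) (simp add: wedge_single ext_sign_def)
  then show ?thesis by (simp flip: ext_expand)
qed

lemma wedge_one_right [simp]: "wedge x (Poly_Mapping.single {} 1) = x"
proof -
  have "wedge x (Poly_Mapping.single {} 1) = (\<Sum>A\<in>Poly_Mapping.keys x. Poly_Mapping.single A (Poly_Mapping.lookup x A))"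
    by (subst wedge_expand) (simp add: wedge_single ext_sign_def)
  then show ?thesis by (simp flip: ext_expand)
qed

lemma ext_sign_union_left:
  assumes "finite A" "finite B" "finite C" "A \<inter> B = {}"
  shows "(ext_sign (A \<union> B) C :: 'r::comm_ring_1) = ext_sign A C * ext_sign B C"
proof -
  have fin: "finite {(a, b). a \<in> X \<and> b \<in> Y \<and> b < a}" if "finite X" "finite Y" for X Y :: "'a set"
    by (rule finite_subset[of _ "X \<times> Y"]) (use that in auto)
  have "{(a, b). a \<in> A \<union> B \<and> b \<in> C \<and> b < a} =
      {(a, b). a \<in> A \<and> b \<in> C \<and> b < a} \<union> {(a, b). a \<in> B \<and> b \<in> C \<and> b < a}" by auto
  then have "card {(a, b). a \<in> A \<union> B \<and> b \<in> C \<and> b < a} =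
      card {(a, b). a \<in> A \<and> b \<in> C \<and> b < a} + card {(a, b). a \<in> B \<and> b \<in> C \<and> b < a}"
    using assms by (simp add: card_Un_disjoint fin disjoint_iff) 
  then show ?thesis by (simp add: ext_sign_def power_add)
qed

lemma ext_sign_union_right:
  assumes "finite A" "finite B" "finite C" "B \<inter> C = {}"
  shows "(ext_sign A (B \<union> C) :: 'r::comm_ring_1) = ext_sign A B * ext_sign A C"
proof -
  have fin: "finite {(a, b). a \<in> X \<and> b \<in> Y \<and> b < a}" if "finite X" "finite Y" for X Y :: "'a set"
    by (rule finite_subset[of _ "X \<times> Y"]) (use that in auto)
  have "{(a, b). a \<in> A \<and> b \<in> B \<union> C \<and> b < a} =
      {(a, b). a \<in> A \<and> b \<in> B \<and> b < a} \<union> {(a, b). a \<in> A \<and> b \<in> C \<and> b < a}" by auto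
  then have "card {(a, b). a \<in> A \<and> b \<in> B \<union> C \<and> b < a} =
      card {(a, b). a \<in> A \<and> b \<in> B \<and> b < a} + card {(a, b). a \<in> A \<and> b \<in> C \<and> b < a}"
    using assms by (simp add: card_Un_disjoint fin disjoint_iff) 
  then show ?thesis by (simp add: ext_sign_def power_add)
qed

lemma wedge_assoc_single:
  assumes "finite A" "finite B" "finite C"
  shows "wedge (wedge (Poly_Mapping.single A r) (Poly_Mapping.single B s)) (Poly_Mapping.single C t) =
         wedge (Poly_Mapping.single A r) (wedge (Poly_Mapping.single B s) (Poly_Mapping.single C (t :: 'r::comm_ring_1)))"
  using assms
  by (auto simp: wedge_single ext_sign_union_left ext_sign_union_right Int_Un_distrib
        Int_Un_distrib2 Un_assoc mult_ac)

lemma wedge_assoc: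
  assumes "x \<in> ext_power UNIV p" "y \<in> ext_power UNIV q" "z \<in> ext_power UNIV s"
  shows "wedge (wedge x y) z = wedge x (wedge y (z :: ('g::linorder, 'r::comm_ring_1) ext))"
proof -
  have *: "finite A" if "A \<in> Poly_Mapping.keys x \<or> A \<in> Poly_Mapping.keys y \<or> A \<in> Poly_Mapping.keys z" for A
    using assms that by (auto simp: ext_power_def)
  have "wedge (wedge x y) z = wedge (wedge (\<Sum>A\<in>Poly_Mapping.keys x. Poly_Mapping.single A (Poly_Mapping.lookup x A))
      (\<Sum>A\<in>Poly_Mapping.keys y. Poly_Mapping.single A (Poly_Mapping.lookup y A))) (\<Sum>A\<in>Poly_Mapping.keys z. Poly_Mapping.single A (Poly_Mapping.lookup z A))"
    by (simp flip: ext_expand)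
  also have "\<dots> = wedge (\<Sum>A\<in>Poly_Mapping.keys x. Poly_Mapping.single A (Poly_Mapping.lookup x A))
      (wedge (\<Sum>A\<in>Poly_Mapping.keys y. Poly_Mapping.single A (Poly_Mapping.lookup y A)) (\<Sum>A\<in>Poly_Mapping.keys z. Poly_Mapping.single A (Poly_Mapping.lookup z A)))"
    by (simp only: wedge_sum_left wedge_sum_right)
       (intro sum.cong refl wedge_assoc_single *, auto)
  finally show ?thesis by (simp flip: ext_expand)
qed

lemma ext_sign_singleton: "ext_sign {a} A = (-1) ^ card {b \<in> A. b < a}"
proof -
  have "{(x, b). x \<in> {a} \<and> b \<in> A \<and> b < x} = Pair a ` {b \<in> A. b < a}" by auto
  then show ?thesis by (simp add: ext_sign_def card_image inj_on_def)
qed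

lemma wedge_generator_self: "wedge (Poly_Mapping.single {a} 1) (Poly_Mapping.single {a} 1) = 0"
  by (simp add: wedge_single)

lemma wedge_generator_swap:
  fixes a b :: "'g::linorder"
  shows "wedge (Poly_Mapping.single {a} 1) (Poly_Mapping.single {b} 1) = - wedge (Poly_Mapping.single {b} 1) (Poly_Mapping.single {a} (1 :: 'r::comm_ring_1))"
proof -
  have "{x. x = u \<and> x < v} = (if u < v then {u} else {})" for u v :: 'g
    by auto
  then show ?thesis
    by (auto simp: wedge_single ext_sign_singleton single_uminus insert_commute not_less)
qed

lemma wedge_basis:
  assumes "\<And>b. b \<in> B \<Longrightarrow> a < b"
  shows "wedge (Poly_Mapping.single {a} 1) (Poly_Mapping.single B 1) = Poly_Mapping.single (insert a B) (1 :: 'r::comm_ring_1)"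
proof -
  have e: "{b \<in> B. b < a} = {}" using assms by fastforce
  have "a \<notin> B" using assms by blast
  then show ?thesis by (simp add: wedge_single ext_sign_singleton e del: Collect_empty_eq)
qed

lemma ext_sign_square [simp]: "ext_sign A B * ext_sign A B = 1"
  by (simp add: ext_sign_def flip: power_mult_distrib)

lemma ext_sign_square' [simp]: "ext_sign A B * (ext_sign A B * x) = x"
  by (simp flip: mult.assoc)

lemma ext_sign_self [simp]: "ext_sign {a} {a} = 1"
proof -
  have e: "{b \<in> {a}. b < a} = {}" by auto
  show ?thesis unfolding ext_sign_singleton e by simp
qed

lemma ext_sign_swap:
  assumes "finite A" "a \<notin> A"
  shows "ext_sign {a} A * ext_sign A {a} = (-1 :: 'r::comm_ring_1) ^ card A"
proof -
  have "{(x, b). x \<in> A \<and> b \<in> {a} \<and> b < x} = (\<lambda>x. (x, a)) ` {b \<in> A. a < b}" by auto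
  then have "ext_sign A {a} = (-1 :: 'r) ^ card {b \<in> A. a < b}"
    by (simp add: ext_sign_def card_image inj_on_def)
  moreover have "card {b \<in> A. b < a} + card {b \<in> A. a < b} = card A"
    using assms by (subst card_Un_disjoint[symmetric]) (auto intro!: arg_cong[of _ _ card] simp: not_less order.order_iff_strict)
  ultimately show ?thesis by (simp add: ext_sign_singleton flip: power_add)
qed

lemma koszul_d_superset:
  assumes "finite T" "Poly_Mapping.keys x \<subseteq> T"
  shows "koszul_d f x = (\<Sum>A\<in>T. \<Sum>a\<in>A.
     Poly_Mapping.single (A - {a}) (ext_sign {a} A * (f a * Poly_Mapping.lookup x A)))"
  unfolding koszul_d_def ext_sign_singleton using assms
  by (intro sum.mono_neutral_left) (auto simp: in_keys_iff)

lemma koszul_d_single: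
  "koszul_d f (Poly_Mapping.single A r) = (\<Sum>a\<in>A. Poly_Mapping.single (A - {a}) (ext_sign {a} A * (f a * r)))"
  by (subst koszul_d_superset[of "{A}"]) auto

lemma koszul_d_generator: "koszul_d f (Poly_Mapping.single {a} 1) = Poly_Mapping.single {} (f a)"
  by (simp add: koszul_d_single)

lemma koszul_d_add: "koszul_d f (x + y) = koszul_d f x + koszul_d f y"
  using keys_add[of x y]
  by (subst (1 2 3) koszul_d_superset[of "Poly_Mapping.keys x \<union> Poly_Mapping.keys y"])
     (auto simp: sum.distrib[symmetric] lookup_add single_add[symmetric] algebra_simps intro!: sum.cong)

lemma koszul_d_scale: "koszul_d f (ext_scale r x) = ext_scale r (koszul_d f x)"
proof -
  have "Poly_Mapping.keys (ext_scale r x) \<subseteq> Poly_Mapping.keys x" by (auto simp: in_keys_iff)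
  then show ?thesis
    by (subst (1 2) koszul_d_superset[of "Poly_Mapping.keys x"])
       (auto simp: ext.scale_sum_right algebra_simps intro!: sum.cong)
qed

lemma koszul_d_zero [simp]: "koszul_d f 0 = 0"
  by (simp add: koszul_d_def)

lemma koszul_d_sum: "koszul_d f (sum h I) = (\<Sum>i\<in>I. koszul_d f (h i))"
  by (induction I rule: infinite_finite_induct) (simp_all add: koszul_d_add)

lemma koszul_d_wedge_single:
  assumes [simp]: "finite A" "finite B"
  shows "koszul_d f (wedge (Poly_Mapping.single A r) (Poly_Mapping.single B s)) =
    wedge (koszul_d f (Poly_Mapping.single A r)) (Poly_Mapping.single B s) +
    ext_scale ((-1) ^ card A) (wedge (Poly_Mapping.single A r) (koszul_d f (Poly_Mapping.single B (s :: 'r::comm_ring_1))))"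
    (is "?L = ?R1 + ?R2")
proof -
  define P where "P a = wedge (Poly_Mapping.single (A - {a}) (ext_sign {a} A * (f a * r))) (Poly_Mapping.single B s)" for a
  define Q where "Q a = ext_scale ((-1) ^ card A)
    (wedge (Poly_Mapping.single A r) (Poly_Mapping.single (B - {a}) (ext_sign {a} B * (f a * s))))" for a
  have R: "?R1 = (\<Sum>a\<in>A. P a)" "?R2 = (\<Sum>a\<in>B. Q a)"
    by (simp_all add: P_def Q_def koszul_d_single wedge_sum_left wedge_sum_right ext.scale_sum_right)
  have splA: "A = {a} \<union> (A - {a})" if "a \<in> A" for a using that by auto
  have splB: "B = {a} \<union> (B - {a})" if "a \<in> B" for a using that by auto
  have sL: "(ext_sign A C :: 'r) = ext_sign {a} C * ext_sign (A - {a}) C"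
    if "a \<in> A" "finite C" for a C
    using that by (subst splA[OF that(1)], subst ext_sign_union_left) auto
  have sR: "(ext_sign C B :: 'r) = ext_sign C {a} * ext_sign C (B - {a})"
    if "a \<in> B" "finite C" for a C
    using that by (subst splB[OF that(1)], subst ext_sign_union_right) auto
  have sR': "(ext_sign C A :: 'r) = ext_sign C {a} * ext_sign C (A - {a})"
    if "a \<in> A" "finite C" for a C
    using that by (subst splA[OF that(1)], subst ext_sign_union_right) auto
  show ?thesis
  proof (cases "A \<inter> B = {}")
    case True
    define T where "T a = Poly_Mapping.single (A \<union> B - {a})
      (ext_sign {a} (A \<union> B) * (f a * (ext_sign A B * (r * s))))" for a
    have "?L = (\<Sum>a\<in>A \<union> B. T a)"
      using True by (simp add: wedge_single koszul_d_single T_def)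
    also have "\<dots> = (\<Sum>a\<in>A. T a) + (\<Sum>a\<in>B. T a)"
      using True by (simp add: sum.union_disjoint)
    also have "(\<Sum>a\<in>A. T a) = (\<Sum>a\<in>A. P a)"
    proof (rule sum.cong[OF refl])
      fix a assume a: "a \<in> A"
      have "ext_sign {a} (A \<union> B) * (f a * (ext_sign A B * (r * s)))
          = ext_sign (A - {a}) B * (ext_sign {a} A * (f a * r) * s)"
        using True a by (simp add: ext_sign_union_right sL[of a B] ac_simps)
      moreover have "A \<union> B - {a} = A - {a} \<union> B" "(A - {a}) \<inter> B = {}" using True a by auto
      ultimately show "T a = P a" by (simp add: T_def P_def wedge_single)
    qed
    also have "(\<Sum>a\<in>B. T a) = (\<Sum>a\<in>B. Q a)"
    proof (rule sum.cong[OF refl])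
      fix a assume a: "a \<in> B"
      then have "a \<notin> A" using True by auto
      have "ext_sign {a} (A \<union> B) * (f a * (ext_sign A B * (r * s)))
          = (ext_sign {a} A * ext_sign A {a}) * (ext_sign A (B - {a}) * (r * (ext_sign {a} B * (f a * s))))"
        using True a by (simp add: ext_sign_union_right sR[of a A] ac_simps)
      also have "\<dots> = (-1) ^ card A * (ext_sign A (B - {a}) * (r * (ext_sign {a} B * (f a * s))))"
        using \<open>a \<notin> A\<close> by (simp add: ext_sign_swap)
      finally have "ext_sign {a} (A \<union> B) * (f a * (ext_sign A B * (r * s))) = \<dots>" .
      moreover have "A \<union> B - {a} = A \<union> (B - {a})" "A \<inter> (B - {a}) = {}" using True a by auto
      ultimately show "T a = Q a" by (simp add: T_def Q_def wedge_single)
    qed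
    finally show ?thesis by (simp add: R)
  next
    case False
    then obtain c where c: "c \<in> A" "c \<in> B" by blast
    have "(\<Sum>a\<in>A. P a) = P c"
    proof -
      have "(\<Sum>a\<in>A. P a) = (\<Sum>a\<in>{c}. P a)"
        using c by (intro sum.mono_neutral_right) (auto simp: P_def wedge_single)
      then show ?thesis by simp
    qed
    moreover have "(\<Sum>a\<in>B. Q a) = Q c"
    proof -
      have "(\<Sum>a\<in>B. Q a) = (\<Sum>a\<in>{c}. Q a)"
        using c by (intro sum.mono_neutral_right) (auto simp: Q_def wedge_single)
      then show ?thesis by simp
    qed
    moreover have "P c + Q c = 0"
    proof (cases "A \<inter> B = {c}")
      case True
      have e: "A - {c} \<union> B = A \<union> (B - {c})" "(A - {c}) \<inter> B = {}" "A \<inter> (B - {c}) = {}"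
        using c True by auto
      have card: "card A = Suc (card (A - {c}))"
        using c by (metis assms(1) card.remove)
      have "ext_sign (A - {c}) B * (ext_sign {c} A * (f c * r) * s) =
          (ext_sign {c} (A - {c}) * ext_sign (A - {c}) {c}) * (ext_sign (A - {c}) (B - {c}) * (f c * (r * s)))"
        using c by (simp add: sR[of c "A - {c}"] sR'[of c "{c}"] ac_simps)
      also have "\<dots> = (-1) ^ card (A - {c}) * (ext_sign (A - {c}) (B - {c}) * (f c * (r * s)))"
        by (simp add: ext_sign_swap)
      finally have 1: "ext_sign (A - {c}) B * (ext_sign {c} A * (f c * r) * s) = \<dots>" .
      have 2: "ext_sign A (B - {c}) * (r * (ext_sign {c} B * (f c * s))) =
          ext_sign (A - {c}) (B - {c}) * (f c * (r * s))"
        using c by (simp add: sL[of c "B - {c}"] sR[of c "{c}"] ac_simps)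
      show ?thesis
        by (simp add: P_def Q_def wedge_single e 1 2 card flip: single_add)
    next
      case nt: False
      then have "(A - {c}) \<inter> B \<noteq> {}" "A \<inter> (B - {c}) \<noteq> {}" using c by auto
      then show ?thesis by (simp add: P_def Q_def wedge_single)
    qed
    ultimately show ?thesis using False R by (simp add: wedge_single)
  qed
qed

lemma koszul_d_wedge:
  assumes "x \<in> ext_power UNIV p" "y \<in> ext_power UNIV q"
  shows "koszul_d f (wedge x y) =
    wedge (koszul_d f x) y + ext_scale ((-1) ^ p) (wedge x (koszul_d f y))"
proof -
  have X: "finite A" "card A = p" if "A \<in> Poly_Mapping.keys x" for A
    using assms that by (auto simp: ext_power_def)
  have Y: "finite A" if "A \<in> Poly_Mapping.keys y" for A
    using assms that by (auto simp: ext_power_def)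
  let ?X = "\<lambda>A. Poly_Mapping.single A (Poly_Mapping.lookup x A)" and ?Y = "\<lambda>A. Poly_Mapping.single A (Poly_Mapping.lookup y A)"
  have "koszul_d f (wedge (\<Sum>A\<in>Poly_Mapping.keys x. ?X A) (\<Sum>B\<in>Poly_Mapping.keys y. ?Y B)) =
      (\<Sum>A\<in>Poly_Mapping.keys x. \<Sum>B\<in>Poly_Mapping.keys y. koszul_d f (wedge (?X A) (?Y B)))"
    by (simp only: wedge_sum_left) (simp only: wedge_sum_right koszul_d_sum)
  also have "\<dots> = (\<Sum>A\<in>Poly_Mapping.keys x. \<Sum>B\<in>Poly_Mapping.keys y. wedge (koszul_d f (?X A)) (?Y B) +
      ext_scale ((-1) ^ p) (wedge (?X A) (koszul_d f (?Y B))))"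
    using X Y by (intro sum.cong refl) (simp add: koszul_d_wedge_single)
  also have "\<dots> = wedge (koszul_d f (\<Sum>A\<in>Poly_Mapping.keys x. ?X A)) (\<Sum>B\<in>Poly_Mapping.keys y. ?Y B) +
      ext_scale ((-1) ^ p) (wedge (\<Sum>A\<in>Poly_Mapping.keys x. ?X A) (koszul_d f (\<Sum>B\<in>Poly_Mapping.keys y. ?Y B)))"
    by (simp only: wedge_sum_left koszul_d_sum)
       (simp only: wedge_sum_right koszul_d_sum sum.distrib ext.scale_sum_right)
  finally show ?thesis by (simp flip: ext_expand)
qed


subsection \<open>The Koszul complex of the monomials of degree \<open>c\<close>\<close>

text \<open>
  A polynomial is a finitely supported function from exponent vectors to coefficients;
  \<open>'n\<close> is the (finite, ordered) index type of the variables, so \<open>n = CARD('n)\<close>.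
\<close>

type_synonym 'n monom = "'n \<Rightarrow>\<^sub>0 nat"
type_synonym ('n, 'k) mpoly = "'n monom \<Rightarrow>\<^sub>0 'k"

definition poly_var :: "'n \<Rightarrow> ('n, 'k::field) mpoly" where
  "poly_var i = Poly_Mapping.single (Poly_Mapping.single i 1) 1"

definition monomials :: "nat \<Rightarrow> ('n::finite) monom set" where
  "monomials c = {u. (\<Sum>i\<in>UNIV. Poly_Mapping.lookup u i) = c}"

definition poly_monom :: "'n monom \<Rightarrow> ('n, 'k::field) mpoly" where
  "poly_monom u = Poly_Mapping.single u 1"

lemma module_mult: "module ((*) :: 'r::comm_ring_1 \<Rightarrow> 'r \<Rightarrow> 'r)"
  by unfold_locales (simp_all add: algebra_simps)

abbreviation ideal_gen :: "'r::comm_ring_1 set \<Rightarrow> 'r set" where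
  "ideal_gen \<equiv> module.span (*)"

primrec ideal_pow :: "'r::comm_ring_1 set \<Rightarrow> nat \<Rightarrow> 'r set" where
  "ideal_pow I 0 = UNIV"
| "ideal_pow I (Suc k) = ideal_gen {a * b | a b. a \<in> I \<and> b \<in> ideal_pow I k}"

definition ideal_smult :: "'r::comm_ring_1 set \<Rightarrow> ('g, 'r) ext set \<Rightarrow> ('g, 'r) ext set" where
  "ideal_smult I N = ext.span {ext_scale a w | a w. a \<in> I \<and> w \<in> N}"

definition max_ideal :: "('n::finite, 'k::field) mpoly set" where
  "max_ideal = ideal_gen (range poly_var)"

text \<open>
  In the following, \<open>c\<close> is the degree of the monomials and \<open>t\<close> the homological degree; the
  generators of the exterior algebra are the exponent vectors of degree \<open>c\<close>, i.e. the monomial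
  basis of \<open>S\<^sub>c\<close>, ordered by the lexicographic order on finitely supported functions.
\<close>

type_synonym ('n, 'k) koszul = "('n monom, ('n, 'k) mpoly) ext"

definition koszul_cycles :: "nat \<Rightarrow> nat \<Rightarrow> ('n::{finite, linorder}, 'k::field) koszul set" where
  "koszul_cycles c t = {z \<in> ext_power (monomials c) t. koszul_d poly_monom z = 0}"

definition koszul_boundaries :: "nat \<Rightarrow> nat \<Rightarrow> ('n::{finite, linorder}, 'k::field) koszul set" where
  "koszul_boundaries c t = koszul_d poly_monom ` ext_power (monomials c) (Suc t)"

text \<open>
  The submodule generated by the products of \<open>t\<close> one-cycles; by \<open>cycles1_power_subset_cycles\<close>
  below it lies in \<open>koszul_cycles c t\<close>.
\<close>

definition cycles1_power :: "nat \<Rightarrow> nat \<Rightarrow> ('n::{finite, linorder}, 'k::field) koszul set" where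
  "cycles1_power c t =
     ext.span {wedge_list zs | zs. length zs = t \<and> set zs \<subseteq> koszul_cycles c 1}"


lemma subspace_ext_power:
  fixes G :: "'g set"
  shows "ext.subspace (ext_power G t :: ('g, 'r::comm_ring_1) ext set)"
proof (rule ext.subspaceI)
  fix x y :: "('g, 'r) ext" assume "x \<in> ext_power G t" "y \<in> ext_power G t"
  then show "x + y \<in> ext_power G t" using keys_add[of x y] by (auto simp: ext_power_def)
next
  fix r and x :: "('g, 'r) ext" assume "x \<in> ext_power G t"
  moreover have "Poly_Mapping.keys (ext_scale r x) \<subseteq> Poly_Mapping.keys x" by (auto simp: in_keys_iff)
  ultimately show "ext_scale r x \<in> ext_power G t" by (auto simp: ext_power_def)
qed (simp add: ext_power_def)

lemma single_in_ext_power: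
  "finite A \<Longrightarrow> A \<subseteq> G \<Longrightarrow> card A = t \<Longrightarrow> Poly_Mapping.single A r \<in> ext_power G t"
  by (simp add: ext_power_def)

lemma wedge_in_ext_power:
  assumes "x \<in> ext_power G p" "y \<in> ext_power G q"
  shows "wedge x y \<in> ext_power G (p + q)"
  unfolding wedge_def using assms
  by (intro ext.subspace_sum[OF subspace_ext_power])
     (auto simp: ext_power_def card_Un_disjoint)

lemma koszul_d_in_ext_power:
  assumes "x \<in> ext_power G (Suc t)"
  shows "koszul_d f x \<in> ext_power G t"
  unfolding koszul_d_def using assms
  by (intro ext.subspace_sum[OF subspace_ext_power] single_in_ext_power)
     (auto simp: ext_power_def)

lemma koszul_d_koszul_d_single:
  "finite A \<Longrightarrow> koszul_d f (koszul_d f (Poly_Mapping.single A (1 :: 'r::comm_ring_1))) = 0"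
proof (induction A rule: finite_linorder_min_induct)
  case empty
  then show ?case by (simp add: koszul_d_single)
next
  case (insert a A)
  define e where "e = Poly_Mapping.single A (1 :: 'r)"
  have e: "e \<in> ext_power UNIV (card A)" using insert by (simp add: e_def single_in_ext_power)
  have a: "Poly_Mapping.single {a} (1 :: 'r) \<in> ext_power UNIV 1" by (simp add: single_in_ext_power)
  have scalar: "wedge (Poly_Mapping.single {} r) x = ext_scale r x" for r :: 'r and x :: "('a, 'r) ext"
    using wedge_scale_left[of r "Poly_Mapping.single {} 1" x] by simp
  have d: "koszul_d f (Poly_Mapping.single (insert a A) 1) = ext_scale (f a) e - wedge (Poly_Mapping.single {a} 1) (koszul_d f e)"
    using insert.hyps
    by (simp add: e_def scalar koszul_d_generator koszul_d_wedge[OF a e[unfolded e_def]]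
          flip: wedge_basis)
  have "koszul_d f (wedge (Poly_Mapping.single {a} 1) (koszul_d f e)) = ext_scale (f a) (koszul_d f e)"
  proof (cases "card A")
    case 0
    then have "koszul_d f e = 0" using insert.hyps by (simp add: e_def koszul_d_single)
    then show ?thesis by simp
  next
    case (Suc t)
    then have "koszul_d f e \<in> ext_power UNIV t" using e by (simp add: koszul_d_in_ext_power)
    from koszul_d_wedge[OF a this, of f] show ?thesis
      using insert.IH by (simp add: scalar koszul_d_generator e_def)
  qed
  moreover have "koszul_d f (x - y) = koszul_d f x - koszul_d f y" for x y :: "('a, 'r) ext"
    using koszul_d_add[of f "x - y" y] by (simp add: algebra_simps)
  ultimately show ?case by (simp add: d koszul_d_scale)
qed

lemma koszul_d_koszul_d:
  assumes "x \<in> ext_power UNIV t"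
  shows "koszul_d f (koszul_d f x) = 0"
proof -
  have "koszul_d f (koszul_d f (Poly_Mapping.single A r)) = 0" if "A \<in> Poly_Mapping.keys x" for A r
  proof -
    have "Poly_Mapping.single A r = ext_scale r (Poly_Mapping.single A 1)" by simp
    moreover have "finite A" using assms that by (auto simp: ext_power_def)
    ultimately show ?thesis
      by (simp only: koszul_d_scale koszul_d_koszul_d_single ext.scale_zero_right)
  qed
  then have "koszul_d f (koszul_d f (\<Sum>A\<in>Poly_Mapping.keys x. Poly_Mapping.single A (Poly_Mapping.lookup x A))) = 0"
    by (simp add: koszul_d_sum)
  then show ?thesis by (simp flip: ext_expand)
qed

lemma ext_power_mono: "G \<subseteq> H \<Longrightarrow> ext_power G t \<subseteq> ext_power H t"
  by (auto simp: ext_power_def)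

lemma boundaries_subset_cycles: "koszul_boundaries c t \<subseteq> koszul_cycles c t"
  using ext_power_mono[OF subset_UNIV]
  by (auto simp: koszul_boundaries_def koszul_cycles_def intro: koszul_d_in_ext_power koszul_d_koszul_d)

lemma subspace_cycles: "ext.subspace (koszul_cycles c t)"
  using subspace_ext_power[of "monomials c" t]
  unfolding ext.subspace_def koszul_cycles_def
  by (auto simp: koszul_d_add koszul_d_scale)

lemma wedge_list_in_cycles:
  "set zs \<subseteq> koszul_cycles c 1 \<Longrightarrow> wedge_list zs \<in> koszul_cycles c (length zs)"
proof (induction zs)
  case Nil
  then show ?case
    by (simp add: koszul_cycles_def wedge_list_def koszul_d_single single_in_ext_power)
next
  case (Cons z zs)
  then have z: "z \<in> ext_power (monomials c) 1" "koszul_d poly_monom z = 0"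
    and w: "wedge_list zs \<in> ext_power (monomials c) (length zs)"
      "koszul_d poly_monom (wedge_list zs) = 0"
    by (auto simp: koszul_cycles_def)
  have "koszul_d poly_monom (wedge z (wedge_list zs)) = 0"
    using koszul_d_wedge[of z 1 "wedge_list zs" "length zs" poly_monom] z w
      ext_power_mono[OF subset_UNIV] by fastforce
  moreover have "wedge z (wedge_list zs) \<in> ext_power (monomials c) (Suc (length zs))"
    using wedge_in_ext_power[OF z(1) w(1)] by simp
  ultimately show ?case by (simp add: koszul_cycles_def wedge_list_def)
qed

lemma cycles1_power_subset_cycles: "cycles1_power c t \<subseteq> koszul_cycles c t"
  unfolding cycles1_power_def
  by (rule ext.span_minimal[OF _ subspace_cycles]) (auto simp del: One_nat_def dest: wedge_list_in_cycles)

end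

theory Submission
  imports Defs "HOL-Combinatorics.Permutations"
begin

text \<open>
  Write \<open>[g]\<close> for the generator of the exterior algebra belonging to the monomial \<open>g\<close>. The
  one-cycles are generated over \<open>S\<close> by the linear syzygies \<open>z\<^sub>b(x, y) = x [y b] - y [x b]\<close>, where
  \<open>x, y\<close> are variables and \<open>b\<close> is a monomial of degree \<open>c - 1\<close>
  (\<open>cycles1_spanned_by_linear_syzygies\<close>), and \<open>m\<^sup>c\<^sup>-\<^sup>1\<close> is generated by the monomials of degree
  \<open>c - 1\<close>. By multilinearity it is enough to treat one product
  \<open>T(u\<^sub>0, \<dots>, u\<^sub>c) = u\<^sub>0 z\<^bsub>u\<^sub>1\<^esub>(x\<^sub>1, y\<^sub>1) \<and> \<dots> \<and> z\<^bsub>u\<^sub>c\<^esub>(x\<^sub>c, y\<^sub>c)\<close> with all \<open>u\<^sub>i\<close> monomials of degree \<open>c - 1\<close>.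

  The point is that the scalar \<open>u\<^sub>0\<close> and the parameters \<open>u\<^sub>1, \<dots>, u\<^sub>c\<close> play the same role modulo
  boundaries. The identity
  \<open>u z\<^sub>b(x, y) + b z\<^sub>u(x, y) = \<partial>([x u] \<and> [y b] - [y u] \<and> [x b])\<close> (\<open>linear_syzygy_exchange\<close>)
  shows that exchanging \<open>u\<^sub>0\<close> with any \<open>u\<^sub>j\<close> changes the sign of \<open>T\<close> modulo boundaries, while the
  pairs \<open>(x\<^sub>j, y\<^sub>j)\<close> stay in place. Hence \<open>T\<close> is alternating in its \<open>c + 1\<close> arguments modulo
  boundaries, and \<open>(c + 1)! T\<close> is congruent to \<open>\<Sum>\<^sub>\<sigma> sgn \<sigma> T(u\<^bsub>\<sigma> 0\<^esub>, \<dots>, u\<^bsub>\<sigma> c\<^esub>)\<close>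
  (\<open>syzygy_product_permute\<close>).

  This alternating sum is a boundary (\<open>alternating_sum_boundary\<close>). Expanding every \<open>z\<close> into its two
  terms writes it as a signed sum of expressions \<open>v\<^sub>1 \<cdots> v\<^sub>c C\<close>, where \<open>v\<^sub>i\<close> is one of \<open>x\<^sub>i, y\<^sub>i\<close>,
  \<open>w\<^sub>i\<close> is the other one, and \<open>C = \<Sum>\<^sub>\<sigma> sgn \<sigma> u\<^bsub>\<sigma> 0\<^esub> [w\<^sub>1 u\<^bsub>\<sigma> 1\<^esub>] \<and> \<dots> \<and> [w\<^sub>c u\<^bsub>\<sigma> c\<^esub>]\<close>. The \<open>j\<close>-th
  part of \<open>\<partial> C\<close> has the coefficients \<open>u\<^bsub>\<sigma> 0\<^esub> w\<^sub>j u\<^bsub>\<sigma> j\<^esub>\<close>, symmetric in the places \<open>0\<close> and \<open>j\<close>, so it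
  cancels against its own sign changes and \<open>C\<close> is a cycle (\<open>alternating_sum_cycle\<close>). Finally
  \<open>v\<^sub>1 \<cdots> v\<^sub>c\<close> is a monomial \<open>v\<close> of degree \<open>c\<close>, and \<open>v C = \<partial>([v] \<and> C)\<close>.

  So \<open>(c + 1)!\<close> enters as the number of permutations; no step divides by an integer, and the
  argument is the same in every characteristic. In the formal statements \<open>d\<close> is the degree
  \<open>c - 1\<close> of the parameters, and monomials are exponent vectors, so that a product of monomials
  appears as a sum.
\<close>

section \<open>Wedge products of elements of degree one\<close>

abbreviation gen :: "'g \<Rightarrow> ('g, 'r::comm_ring_1) ext" where
  "gen g \<equiv> Poly_Mapping.single {g} 1"

lemma ext_power_UNIV: "x \<in> ext_power G t \<Longrightarrow> x \<in> ext_power UNIV t"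
  using ext_power_mono[OF subset_UNIV] by blast

lemma gen_in_ext_power: "g \<in> G \<Longrightarrow> gen g \<in> ext_power G 1"
  by (simp add: single_in_ext_power)

lemma ext_power_1_span: "ext_power G 1 \<subseteq> ext.span (gen ` G :: ('g, 'r::comm_ring_1) ext set)"
proof
  fix x :: "('g, 'r) ext" assume x: "x \<in> ext_power G 1"
  have "Poly_Mapping.single A (Poly_Mapping.lookup x A) \<in> ext.span (gen ` G)"
    if "A \<in> Poly_Mapping.keys x" for A
  proof -
    from x that have A: "card A = 1" "A \<subseteq> G" by (auto simp: ext_power_def)
    then obtain g where "A = {g}" "g \<in> G" by (metis card_1_singletonE insert_subset)
    then have "Poly_Mapping.single A (Poly_Mapping.lookup x A) = ext_scale (Poly_Mapping.lookup x A) (gen g)"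
      by simp
    then show ?thesis using \<open>g \<in> G\<close> by (metis ext.span_base ext.span_scale imageI)
  qed
  then show "x \<in> ext.span (gen ` G)"
    by (subst ext_expand) (rule ext.span_sum)
qed

lemma wedge_minus_left: "wedge (- x) y = - wedge x y"
  using wedge_scale_left[of "-1" x y] by (simp add: ext.scale_minus_left)

lemma wedge_minus_right: "wedge x (- y) = - wedge x y"
  using wedge_scale_right[of x "-1" y] by (simp add: ext.scale_minus_left)

lemma wedge_diff_left: "wedge (x - y) z = wedge x z - wedge y z"
  using wedge_add_left[of x "- y" z] by (simp add: wedge_minus_left)

lemma wedge_diff_right: "wedge z (x - y) = wedge z x - wedge z y"
  using wedge_add_right[of z x "- y"] by (simp add: wedge_minus_right)

lemma koszul_d_diff: "koszul_d f (x - y) = koszul_d f x - koszul_d f y"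
  using koszul_d_add[of f "x - y" y] by (simp add: algebra_simps)

lemma wedge_anticommute:
  assumes "x \<in> ext_power UNIV 1" "y \<in> ext_power UNIV 1"
  shows "wedge x y = - wedge y (x :: ('g::linorder, 'r::comm_ring_1) ext)"
proof -
  have gen: "wedge (gen a) y = - wedge y (gen a)" for a :: 'g
  proof -
    have "y \<in> ext.span (range gen)" using assms(2) ext_power_1_span by blast
    then show ?thesis
    proof (induction rule: ext.span_induct_alt)
      case (step c z w)
      then obtain b where z: "z = gen b" by blast
      have "ext_scale c (wedge (gen a) z) = - ext_scale c (wedge z (gen a))"
        unfolding z by (subst wedge_generator_swap) (rule ext.scale_minus_right)
      then show ?case using step.IH
        by (simp add: wedge_add_left wedge_add_right wedge_scale_left wedge_scale_right)
    qed simp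
  qed
  have "x \<in> ext.span (range gen)" using assms(1) ext_power_1_span by blast
  then show ?thesis
  proof (induction rule: ext.span_induct_alt)
    case (step c z w)
    then obtain b where z: "z = gen b" by blast
    have "ext_scale c (wedge z y) = - ext_scale c (wedge y z)"
      unfolding z by (subst gen) (rule ext.scale_minus_right)
    then show ?case using step.IH
      by (simp add: wedge_add_left wedge_add_right wedge_scale_left wedge_scale_right)
  qed simp
qed

lemma wedge_list_simps [simp]:
  "wedge_list [] = Poly_Mapping.single {} 1"
  "wedge_list (x # xs) = wedge x (wedge_list xs)"
  by (simp_all add: wedge_list_def)

lemma wedge_list_in_ext_power:
  "set xs \<subseteq> ext_power G 1 \<Longrightarrow> wedge_list xs \<in> ext_power G (length xs)"
proof (induction xs)
  case (Cons x xs)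
  then show ?case using wedge_in_ext_power[of x G 1 "wedge_list xs" "length xs"] by simp
qed (simp add: single_in_ext_power)

text \<open>
  Moving one factor to the front costs one sign per factor passed, and the remaining product no
  longer depends on it. This lets an identity for a single factor be applied inside a product.
\<close>

lemma wedge_list_front:
  assumes "set xs \<subseteq> ext_power UNIV 1" "a \<in> ext_power UNIV 1" "set ys \<subseteq> ext_power UNIV 1"
  shows "wedge_list (xs @ a # ys) = ext_scale ((-1) ^ length xs) (wedge a (wedge_list (xs @ ys)))"
  using assms(1)
proof (induction xs)
  case (Cons x xs)
  let ?W = "wedge_list (xs @ ys)"
  have x: "x \<in> ext_power UNIV 1" and W: "?W \<in> ext_power UNIV (length (xs @ ys))"
    using Cons.prems assms by (auto simp del: length_append intro!: wedge_list_in_ext_power)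
  have "wedge x (wedge a ?W) = - wedge a (wedge x ?W)"
    by (simp only: wedge_assoc[OF x assms(2) W, symmetric] wedge_assoc[OF assms(2) x W, symmetric]
        wedge_anticommute[OF x assms(2)] wedge_minus_left)
  then show ?case using Cons
    by (simp add: wedge_scale_right ext.scale_minus_left)
qed simp

lemma wedge_list_linear:
  "wedge_list (xs @ (a + b) # ys) = wedge_list (xs @ a # ys) + wedge_list (xs @ b # ys)"
  "wedge_list (xs @ (a - b) # ys) = wedge_list (xs @ a # ys) - wedge_list (xs @ b # ys)"
  "wedge_list (xs @ ext_scale r a # ys) = ext_scale r (wedge_list (xs @ a # ys))"
  "wedge_list (xs @ 0 # ys) = 0"
  by (induction xs) (simp_all add: wedge_add_left wedge_add_right wedge_diff_left wedge_diff_right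
      wedge_scale_left wedge_scale_right)

lemma wedge_list_scale:
  "wedge_list (map (\<lambda>i. ext_scale (r i) (x i)) is) = ext_scale (\<Prod>i\<leftarrow>is. r i) (wedge_list (map x is))"
  by (induction "is") (simp_all add: wedge_scale_left wedge_scale_right mult.commute)

lemma koszul_d_wedge_cycle:
  assumes "x \<in> ext_power UNIV p" "w \<in> ext_power UNIV q" "koszul_d f w = 0"
  shows "koszul_d f (wedge x w) = wedge (koszul_d f x) w"
  using koszul_d_wedge[OF assms(1,2), of f] assms(3) by simp

lemma wedge_scalar: "wedge (Poly_Mapping.single {} r) x = ext_scale r x"
  using wedge_scale_left[of r "Poly_Mapping.single {} 1" x] by simp

text \<open>
  The Leibniz rule, iterated. Cutting the \<open>j\<close>-th entry out of the list shows that the \<open>j\<close>-th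
  product does not depend on the generator removed, which is what makes alternating sums cancel.
\<close>

lemma koszul_d_gens:
  fixes f :: "'g::linorder \<Rightarrow> 'r::comm_ring_1"
  shows "koszul_d f (wedge_list (map gen l)) =
    (\<Sum>j<length l. ext_scale ((-1) ^ j * f (l ! j)) (wedge_list (map gen (take j l @ drop (Suc j) l))))"
proof (induction l)
  case Nil
  then show ?case by (simp add: koszul_d_single)
next
  case (Cons a l)
  have a: "(gen a :: ('g, 'r) ext) \<in> ext_power UNIV 1" by (rule gen_in_ext_power) simp
  have "set (map gen l) \<subseteq> (ext_power UNIV 1 :: ('g, 'r) ext set)"
    by (auto simp: single_in_ext_power)
  then have l: "(wedge_list (map gen l) :: ('g, 'r) ext) \<in> ext_power UNIV (length (map gen l :: ('g, 'r) ext list))"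
    by (rule wedge_list_in_ext_power)
  have "koszul_d f (wedge_list (map gen (a # l))) = ext_scale (f a) (wedge_list (map gen l)) -
      wedge (gen a) (\<Sum>j<length l. ext_scale ((-1) ^ j * f (l ! j)) (wedge_list (map gen (take j l @ drop (Suc j) l))))"
    using koszul_d_wedge[OF a l, of f] Cons.IH
    by (simp add: koszul_d_generator wedge_scalar ext.scale_minus_left)
  then show ?case
    by (simp del: sum.lessThan_Suc add: sum.lessThan_Suc_shift wedge_sum_right wedge_scale_right
        ext.scale_minus_left sum_negf)
qed

section \<open>Boundaries of the Koszul complex\<close>

lemma subspace_boundaries:
  "ext.subspace (koszul_boundaries c t :: ('n::{finite, linorder}, 'k::field) koszul set)"
proof (rule ext.subspaceI)
  show "(0 :: ('n, 'k) koszul) \<in> koszul_boundaries c t"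
    unfolding koszul_boundaries_def using ext.subspace_0[OF subspace_ext_power]
    by (metis image_eqI koszul_d_zero)
next
  fix x y :: "('n, 'k) koszul" assume "x \<in> koszul_boundaries c t" "y \<in> koszul_boundaries c t"
  then obtain p q where "p \<in> ext_power (monomials c) (Suc t)" "q \<in> ext_power (monomials c) (Suc t)"
    and "x + y = koszul_d poly_monom (p + q)"
    unfolding koszul_boundaries_def by (auto simp: koszul_d_add)
  then show "x + y \<in> koszul_boundaries c t"
    unfolding koszul_boundaries_def using ext.subspace_add[OF subspace_ext_power] by blast
next
  fix r and x :: "('n, 'k) koszul" assume "x \<in> koszul_boundaries c t"
  then obtain p where "p \<in> ext_power (monomials c) (Suc t)" "ext_scale r x = koszul_d poly_monom (ext_scale r p)"
    unfolding koszul_boundaries_def by (auto simp: koszul_d_scale)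
  then show "ext_scale r x \<in> koszul_boundaries c t"
    unfolding koszul_boundaries_def using ext.subspace_scale[OF subspace_ext_power] by blast
qed

text \<open>
  Multiplication by \<open>v\<close> is null-homotopic via \<open>w \<mapsto> [v] \<and> w\<close>: the boundary of \<open>[v] \<and> w\<close> is
  \<open>v w\<close> when \<open>w\<close> is a cycle.
\<close>

lemma monomial_cycle_boundary:
  assumes "v \<in> monomials c" "w \<in> koszul_cycles c t"
  shows "ext_scale (poly_monom v) w \<in> koszul_boundaries c t"
proof -
  have "koszul_d poly_monom (wedge (gen v) w) = ext_scale (poly_monom v) w"
    using koszul_d_wedge_cycle[of "gen v" 1 w t poly_monom] assms
    by (auto simp: koszul_cycles_def gen_in_ext_power koszul_d_generator wedge_scalar
        single_in_ext_power intro: ext_power_UNIV)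
  moreover have "wedge (gen v) w \<in> ext_power (monomials c) (Suc t)"
    using wedge_in_ext_power[of "gen v" "monomials c" 1 w t] assms
    by (simp add: koszul_cycles_def single_in_ext_power)
  ultimately show ?thesis unfolding koszul_boundaries_def by (metis imageI)
qed

lemma boundary_wedge_cycle:
  assumes "s \<in> ext_power (monomials c) (Suc p)" "w \<in> koszul_cycles c t"
  shows "wedge (koszul_d poly_monom s) w \<in> koszul_boundaries c (p + t)"
proof -
  have "koszul_d poly_monom (wedge s w) = wedge (koszul_d poly_monom s) w"
    using assms by (intro koszul_d_wedge_cycle) (auto simp: koszul_cycles_def intro: ext_power_UNIV)
  moreover have "wedge s w \<in> ext_power (monomials c) (Suc (p + t))"
    using wedge_in_ext_power[OF assms(1), of w t] assms(2) by (simp add: koszul_cycles_def)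
  ultimately show ?thesis unfolding koszul_boundaries_def by (metis imageI)
qed

lemma poly_monom_add: "poly_monom (u + v) = poly_monom u * poly_monom v"
  by (simp add: poly_monom_def mult_single)

lemma monomials_add: "u \<in> monomials c \<Longrightarrow> v \<in> monomials d \<Longrightarrow> u + v \<in> monomials (c + d)"
  by (simp add: monomials_def lookup_add sum.distrib)

section \<open>Linear syzygies and the exchange relation\<close>

definition linear_syzygy :: "'n monom \<Rightarrow> 'n monom \<Rightarrow> 'n monom \<Rightarrow> ('n::{finite, linorder}, 'k::field) koszul" where
  "linear_syzygy x y b = ext_scale (poly_monom x) (gen (y + b)) - ext_scale (poly_monom y) (gen (x + b))"

lemma linear_syzygy_cycle:
  assumes "x \<in> monomials 1" "y \<in> monomials 1" "b \<in> monomials d"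
  shows "linear_syzygy x y b \<in> koszul_cycles (Suc d) 1"
proof -
  have "gen (x + b) \<in> ext_power (monomials (Suc d)) 1" "gen (y + b) \<in> ext_power (monomials (Suc d)) 1"
    using monomials_add[OF assms(1,3)] monomials_add[OF assms(2,3)] by (simp_all add: single_in_ext_power)
  then have "linear_syzygy x y b \<in> ext_power (monomials (Suc d)) 1"
    unfolding linear_syzygy_def
    by (intro ext.subspace_diff[OF subspace_ext_power] ext.subspace_scale[OF subspace_ext_power])
  moreover have "koszul_d poly_monom (linear_syzygy x y b) = 0"
    by (simp add: linear_syzygy_def koszul_d_diff koszul_d_scale koszul_d_generator poly_monom_add
        mult.left_commute del: ext_scale_single) (simp add: mult.left_commute)
  ultimately show ?thesis by (simp add: koszul_cycles_def)
qed

text \<open>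
  The scalar \<open>u\<close> and the parameter \<open>b\<close> may be exchanged up to sign and a boundary. The four terms
  on the left are regrouped by the pairs of generators \<open>x u, y b\<close> and \<open>y u, x b\<close>; each pair is a
  Koszul relation.
\<close>

lemma linear_syzygy_exchange:
  fixes x y u b :: "'n::{finite, linorder} monom"
  shows
  "ext_scale (poly_monom u) (linear_syzygy x y b) + ext_scale (poly_monom b) (linear_syzygy x y u) =
   koszul_d poly_monom (wedge (gen (x + u)) (gen (y + b)) - wedge (gen (y + u)) (gen (x + b)) :: ('n, 'k::field) koszul)"
proof -
  have d: "koszul_d poly_monom (wedge (gen g) (gen h) :: ('n, 'k) koszul) =
      ext_scale (poly_monom g) (gen h) - ext_scale (poly_monom h) (gen g)" for g h :: "'n monom"
  proof -
    have "wedge (gen g) (Poly_Mapping.single {} r) = ext_scale r (gen g :: ('n, 'k) koszul)" for r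
      using wedge_scale_right[of "gen g" r "Poly_Mapping.single {} 1"] by simp
    moreover have "koszul_d poly_monom (wedge (gen g) (gen h)) = wedge (koszul_d poly_monom (gen g)) (gen h)
        - wedge (gen g) (koszul_d poly_monom (gen h) :: ('n, 'k) koszul)"
      using koszul_d_wedge[of "gen g" 1 "gen h :: ('n, 'k) koszul" 1 poly_monom]
      by (simp add: single_in_ext_power ext.scale_minus_left del: ext_scale_single)
    ultimately show ?thesis by (simp only: koszul_d_generator wedge_scalar)
  qed
  show ?thesis
    by (simp add: d koszul_d_diff linear_syzygy_def ext.scale_right_diff_distrib poly_monom_add mult.commute
        del: ext_scale_single)
qed

section \<open>Alternating sums\<close>

text \<open>
  The permutations are paired off by composition with a transposition. Pairing even with odd ones,
  rather than deducing that the sum equals its own negative, keeps the statement valid in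
  characteristic two.
\<close>

lemma alternating_sum_symmetric:
  fixes F :: "('a \<Rightarrow> 'a) \<Rightarrow> ('g, 'r::comm_ring_1) ext"
  assumes "finite S" "a \<in> S" "b \<in> S" "a \<noteq> b"
    and sym: "\<And>\<sigma>. \<sigma> permutes S \<Longrightarrow> F (\<sigma> \<circ> transpose a b) = F \<sigma>"
  shows "(\<Sum>\<sigma> | \<sigma> permutes S. ext_scale (of_int (sign \<sigma>)) (F \<sigma>)) = 0"
proof -
  let ?\<tau> = "transpose a b"
  let ?E = "{\<sigma>. \<sigma> permutes S \<and> evenperm \<sigma>}" and ?O = "{\<sigma>. \<sigma> permutes S \<and> \<not> evenperm \<sigma>}"
  have fin: "finite {\<sigma>. \<sigma> permutes S}" using assms(1) by (rule finite_permutations)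
  have \<tau>: "?\<tau> permutes S" using assms by (simp add: permutes_swap_id)
  have flip: "evenperm (\<sigma> \<circ> ?\<tau>) \<longleftrightarrow> \<not> evenperm \<sigma>" if "\<sigma> permutes S" for \<sigma>
    using that assms(1,4) permutation_swap_id[of a b]
    by (subst evenperm_comp) (auto simp: permutation_permutes evenperm_swap)
  have "bij_betw (\<lambda>\<sigma>. \<sigma> \<circ> ?\<tau>) ?E ?O"
    by (rule bij_betw_byWitness[where f' = "\<lambda>\<sigma>. \<sigma> \<circ> ?\<tau>"])
       (auto simp: flip comp_assoc intro: permutes_compose[OF \<tau>])
  then have "(\<Sum>\<sigma>\<in>?O. F \<sigma>) = (\<Sum>\<sigma>\<in>?E. F (\<sigma> \<circ> ?\<tau>))"
    by (rule sum.reindex_bij_betw[symmetric])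
  also have "\<dots> = (\<Sum>\<sigma>\<in>?E. F \<sigma>)" by (rule sum.cong) (auto simp: sym)
  finally have eq: "(\<Sum>\<sigma>\<in>?O. F \<sigma>) = (\<Sum>\<sigma>\<in>?E. F \<sigma>)" .
  have "{\<sigma>. \<sigma> permutes S} = ?E \<union> ?O" by auto
  then have "(\<Sum>\<sigma> | \<sigma> permutes S. ext_scale (of_int (sign \<sigma>)) (F \<sigma>)) =
      (\<Sum>\<sigma>\<in>?E. ext_scale (of_int (sign \<sigma>)) (F \<sigma>)) + (\<Sum>\<sigma>\<in>?O. ext_scale (of_int (sign \<sigma>)) (F \<sigma>))"
    using fin by (metis (no_types, lifting) finite_Un sum.union_disjoint disjoint_iff mem_Collect_eq)
  also have "\<dots> = (\<Sum>\<sigma>\<in>?E. F \<sigma>) + (\<Sum>\<sigma>\<in>?O. - F \<sigma>)"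
    by (intro arg_cong2[of _ _ _ _ "(+)"] sum.cong) (auto simp: sign_def ext.scale_minus_left)
  finally show ?thesis by (simp add: sum_negf eq)
qed

text \<open>
  Removing the \<open>j\<close>-th generator from the product (counting from \<open>0\<close>) leaves the coefficient
  \<open>U (\<sigma> 0) + W j + U (\<sigma> (Suc j))\<close> (as an exponent), which is symmetric in the places \<open>0\<close> and
  \<open>Suc j\<close>, and a product of generators in which neither \<open>\<sigma> 0\<close> nor \<open>\<sigma> (Suc j)\<close> occurs. Hence the
  alternating sum over \<open>\<sigma>\<close> vanishes for each \<open>j\<close> separately.
\<close>

lemma alternating_sum_cycle:
  fixes U W :: "nat \<Rightarrow> 'n::{finite, linorder} monom"
  assumes U: "\<And>i. i \<le> m \<Longrightarrow> U i \<in> monomials d" and W: "\<And>i. i < m \<Longrightarrow> W i \<in> monomials 1"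
  shows "(\<Sum>\<sigma> | \<sigma> permutes {..m}. ext_scale (of_int (sign \<sigma>)) (ext_scale (poly_monom (U (\<sigma> 0)))
      (wedge_list (map gen (map (\<lambda>i. W i + U (\<sigma> (Suc i))) [0..<m])))))
    \<in> (koszul_cycles (Suc d) m :: ('n, 'k::field) koszul set)"
proof -
  define h where "h \<sigma> = map (\<lambda>i. W i + U (\<sigma> (Suc i))) [0..<m]" for \<sigma>
  define F :: "nat \<Rightarrow> (nat \<Rightarrow> nat) \<Rightarrow> ('n, 'k) koszul" where
    "F j \<sigma> = ext_scale (poly_monom (U (\<sigma> 0)) * ((-1) ^ j * poly_monom (W j + U (\<sigma> (Suc j)))))
        (wedge_list (map gen (take j (h \<sigma>) @ drop (Suc j) (h \<sigma>))))" for j \<sigma>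
  have mem: "set (map gen (h \<sigma>)) \<subseteq> (ext_power (monomials (Suc d)) 1 :: ('n, 'k) koszul set)" if "\<sigma> permutes {..m}" for \<sigma>
  proof -
    have "W i + U (\<sigma> (Suc i)) \<in> monomials (Suc d)" if "i < m" for i
    proof -
      have "\<sigma> (Suc i) \<in> {..m}" using that \<open>\<sigma> permutes {..m}\<close> by (simp only: permutes_in_image) simp
      then show ?thesis using monomials_add[OF W[OF that] U] by simp
    qed
    then show ?thesis by (auto simp: h_def single_in_ext_power)
  qed
  have pow: "wedge_list (map gen (h \<sigma>)) \<in> (ext_power (monomials (Suc d)) m :: ('n, 'k) koszul set)" if "\<sigma> permutes {..m}" for \<sigma>
    using wedge_list_in_ext_power[OF mem[OF that]] by (simp add: h_def)
  have "koszul_d poly_monom (\<Sum>\<sigma> | \<sigma> permutes {..m}. ext_scale (of_int (sign \<sigma>)) (ext_scale (poly_monom (U (\<sigma> 0)))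
      (wedge_list (map gen (h \<sigma>))))) = (\<Sum>\<sigma> | \<sigma> permutes {..m}. \<Sum>j<m. ext_scale (of_int (sign \<sigma>)) (F j \<sigma>))"
    unfolding koszul_d_sum koszul_d_scale koszul_d_gens ext.scale_sum_right
    by (intro sum.cong) (auto simp: F_def h_def)
  also have "\<dots> = (\<Sum>j<m. \<Sum>\<sigma> | \<sigma> permutes {..m}. ext_scale (of_int (sign \<sigma>)) (F j \<sigma>))"
    by (rule sum.swap)
  also have "\<dots> = 0"
  proof (rule sum.neutral, rule ballI)
    fix j assume j: "j \<in> {..<m}"
    have omit: "take j (h \<sigma>) @ drop (Suc j) (h \<sigma>) =
        map (\<lambda>i. W i + U (\<sigma> (Suc i))) ([0..<j] @ [Suc j..<m])" for \<sigma>
      using j by (simp add: h_def take_map drop_map)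
    show "(\<Sum>\<sigma> | \<sigma> permutes {..m}. ext_scale (of_int (sign \<sigma>)) (F j \<sigma>)) = 0"
    proof (rule alternating_sum_symmetric[of "{..m}" 0 "Suc j"])
      fix \<sigma> :: "nat \<Rightarrow> nat"
      have "map (\<lambda>i. W i + U ((\<sigma> \<circ> transpose 0 (Suc j)) (Suc i))) ([0..<j] @ [Suc j..<m]) =
          map (\<lambda>i. W i + U (\<sigma> (Suc i))) ([0..<j] @ [Suc j..<m])"
        by (auto simp: transpose_def)
      then show "F j (\<sigma> \<circ> transpose 0 (Suc j)) = F j \<sigma>"
        by (simp only: F_def omit) (simp add: poly_monom_add mult_ac)
    qed (use j in auto)
  qed
  finally show ?thesis
    unfolding koszul_cycles_def h_def[symmetric]
    by (auto intro!: ext.subspace_sum[OF subspace_ext_power] ext.subspace_scale[OF subspace_ext_power] pow)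
qed

lemma split_upt: "k < m \<Longrightarrow> [0..<m] = [0..<k] @ k # [Suc k..<m]"
  using upt_add_eq_append[of 0 k "m - k"] upt_conv_Cons[of k m] by simp

text \<open>
  The factors of the product are expanded one at a time: the first \<open>k\<close> have already been replaced
  by a single term \<open>x [y u]\<close>. For \<open>k = Suc d\<close> the scalars \<open>X i\<close> multiply up to a monomial of degree
  \<open>Suc d\<close> that does not depend on \<open>\<sigma>\<close>, and its cofactor is an alternating sum of products of
  generators, hence a cycle. For the passage from \<open>Suc k\<close> to \<open>k\<close>, the second term of the \<open>k\<close>-th
  linear syzygy is the first one with \<open>X k\<close> and \<open>Y k\<close> interchanged, so the claim is needed for
  all \<open>X\<close> and \<open>Y\<close>.
\<close>

lemma alternating_sum_boundary:
  fixes U X Y :: "nat \<Rightarrow> 'n::{finite, linorder} monom"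
  assumes U: "\<And>i. i \<le> Suc d \<Longrightarrow> U i \<in> monomials d"
    and XY: "\<And>i. i \<le> d \<Longrightarrow> X i \<in> monomials 1 \<and> Y i \<in> monomials 1"
    and "k \<le> Suc d"
  shows "(\<Sum>\<sigma> | \<sigma> permutes {..Suc d}. ext_scale (of_int (sign \<sigma>)) (ext_scale (poly_monom (U (\<sigma> 0)))
      (wedge_list (map (\<lambda>i. if i < k then ext_scale (poly_monom (X i)) (gen (Y i + U (\<sigma> (Suc i))))
         else linear_syzygy (X i) (Y i) (U (\<sigma> (Suc i)))) [0..<Suc d]))))
    \<in> (koszul_boundaries (Suc d) (Suc d) :: ('n, 'k::field) koszul set)"
  using \<open>k \<le> Suc d\<close> XY
proof (induction k arbitrary: X Y rule: inc_induct)
  case base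
  have prod: "(\<Prod>i\<leftarrow>is. poly_monom (X i)) = (poly_monom (\<Sum>i\<leftarrow>is. X i) :: ('n, 'k) mpoly)" for "is"
    by (induction "is") (simp_all add: poly_monom_add, simp add: poly_monom_def)
  have "(\<Sum>i\<leftarrow>is. X i) \<in> monomials (length is)" if "set is \<subseteq> {..d}" for "is"
    using that
  proof (induction "is")
    case (Cons i "is")
    then show ?case using monomials_add[of "X i" 1 "\<Sum>i\<leftarrow>is. X i" "length is"] base by simp
  qed (simp add: monomials_def)
  from this[of "[0..<Suc d]"] have deg: "(\<Sum>i\<leftarrow>[0..<Suc d]. X i) \<in> monomials (Suc d)"
    by (simp add: atLeast0LessThan lessThan_Suc_atMost del: upt_Suc)
  define C :: "(nat \<Rightarrow> nat) \<Rightarrow> ('n, 'k) koszul" where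
    "C \<sigma> = wedge_list (map gen (map (\<lambda>i. Y i + U (\<sigma> (Suc i))) [0..<Suc d]))" for \<sigma>
  have "wedge_list (map (\<lambda>i. if i < Suc d then ext_scale (poly_monom (X i)) (gen (Y i + U (\<sigma> (Suc i))))
         else linear_syzygy (X i) (Y i) (U (\<sigma> (Suc i)))) [0..<Suc d]) =
      ext_scale (poly_monom (\<Sum>i\<leftarrow>[0..<Suc d]. X i)) (C \<sigma>)" for \<sigma>
  proof -
    have "map (\<lambda>i. if i < Suc d then ext_scale (poly_monom (X i)) (gen (Y i + U (\<sigma> (Suc i))))
         else linear_syzygy (X i) (Y i) (U (\<sigma> (Suc i)))) [0..<Suc d] =
       (map (\<lambda>i. ext_scale (poly_monom (X i)) (gen (Y i + U (\<sigma> (Suc i))))) [0..<Suc d] :: ('n, 'k) koszul list)"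
      by (rule map_cong) auto
    then show ?thesis by (simp only: wedge_list_scale prod C_def map_map o_def)
  qed
  moreover have "ext_scale (poly_monom (\<Sum>i\<leftarrow>[0..<Suc d]. X i))
      (\<Sum>\<sigma> | \<sigma> permutes {..Suc d}. ext_scale (of_int (sign \<sigma>)) (ext_scale (poly_monom (U (\<sigma> 0))) (C \<sigma>)))
      \<in> koszul_boundaries (Suc d) (Suc d)"
    unfolding C_def using base U by (intro monomial_cycle_boundary deg alternating_sum_cycle) auto
  ultimately show ?case
    by (simp only: ext.scale_sum_right ext.scale_scale mult_ac)
next
  case (step k)
  let ?g = "\<lambda>j X Y \<sigma> i. if i < j then ext_scale (poly_monom (X i)) (gen (Y i + U (\<sigma> (Suc i))))
         else linear_syzygy (X i) (Y i) (U (\<sigma> (Suc i))) :: ('n, 'k) koszul"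
  let ?A = "\<lambda>j X Y. \<Sum>\<sigma> | \<sigma> permutes {..Suc d}. ext_scale (of_int (sign \<sigma>)) (ext_scale (poly_monom (U (\<sigma> 0)))
      (wedge_list (map (?g j X Y \<sigma>) [0..<Suc d])))"
  \<comment> \<open>These give the second term of the \<open>k\<close>-th linear syzygy.\<close>
  let ?X = "X(k := Y k)" and ?Y = "Y(k := X k)"
  have "wedge_list (map (?g k X Y \<sigma>) [0..<Suc d]) =
      wedge_list (map (?g (Suc k) X Y \<sigma>) [0..<Suc d]) - wedge_list (map (?g (Suc k) ?X ?Y \<sigma>) [0..<Suc d])" for \<sigma>
  proof -
    have 1: "map (?g (Suc k) X Y \<sigma>) [0..<k] = map (?g k X Y \<sigma>) [0..<k]"
      "map (?g (Suc k) X Y \<sigma>) [Suc k..<Suc d] = map (?g k X Y \<sigma>) [Suc k..<Suc d]"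
      "map (?g (Suc k) ?X ?Y \<sigma>) [0..<k] = map (?g k X Y \<sigma>) [0..<k]"
      "map (?g (Suc k) ?X ?Y \<sigma>) [Suc k..<Suc d] = map (?g k X Y \<sigma>) [Suc k..<Suc d]"
      by (auto simp del: upt_Suc)
    have 2: "?g k X Y \<sigma> k = ?g (Suc k) X Y \<sigma> k - ?g (Suc k) ?X ?Y \<sigma> k"
      by (simp add: linear_syzygy_def)
    show ?thesis
      unfolding split_upt[OF step(2)] map_append list.map(2) 1 2 wedge_list_linear ..
  qed
  then have "?A k X Y = ?A (Suc k) X Y - ?A (Suc k) ?X ?Y"
    by (simp only: ext.scale_right_diff_distrib sum_subtractf)
  moreover have "?A (Suc k) X Y \<in> koszul_boundaries (Suc d) (Suc d)"
    by (rule step.IH) (use step.prems in auto)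
  moreover have "?A (Suc k) ?X ?Y \<in> koszul_boundaries (Suc d) (Suc d)"
    by (rule step.IH) (use step.prems in auto)
  ultimately show ?case by (simp only: ext.subspace_diff[OF subspace_boundaries])
qed

section \<open>Products of linear syzygies are alternating modulo boundaries\<close>

text \<open>
  The scalar is stored as the value of \<open>U\<close> at \<open>0\<close>, ahead of the parameters of the syzygies, so that
  permutations of \<open>{..m}\<close> act on all \<open>m + 1\<close> of them at once.
\<close>

definition syzygy_product :: "(nat \<Rightarrow> 'n monom) \<Rightarrow> (nat \<Rightarrow> 'n monom) \<Rightarrow> nat \<Rightarrow> (nat \<Rightarrow> 'n monom) \<Rightarrow> ('n::{finite, linorder}, 'k::field) koszul" where
  "syzygy_product X Y m U = ext_scale (poly_monom (U 0))
     (wedge_list (map (\<lambda>i. linear_syzygy (X i) (Y i) (U (Suc i))) [0..<m]))"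

text \<open>
  The factor with parameter \<open>U (Suc j)\<close> is brought to the front; the exchange relation then writes
  the sum, up to sign, as \<open>\<partial>s \<and> w\<close> with \<open>w\<close> the product of the other factors. Since \<open>w\<close> is a
  cycle, \<open>\<partial>s \<and> w\<close> is the boundary of \<open>s \<and> w\<close>.
\<close>

lemma syzygy_product_star_transpose:
  fixes U X Y :: "nat \<Rightarrow> 'n::{finite, linorder} monom"
  assumes U: "\<And>i. i \<le> m \<Longrightarrow> U i \<in> monomials d"
    and XY: "\<And>i. i < m \<Longrightarrow> X i \<in> monomials 1 \<and> Y i \<in> monomials 1"
    and j: "j < m"
  shows "syzygy_product X Y m (U \<circ> transpose 0 (Suc j)) + syzygy_product X Y m U
    \<in> (koszul_boundaries (Suc d) m :: ('n, 'k::field) koszul set)"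
proof -
  define xs ys :: "('n, 'k) koszul list"
    where "xs = map (\<lambda>i. linear_syzygy (X i) (Y i) (U (Suc i))) [0..<j]"
      and "ys = map (\<lambda>i. linear_syzygy (X i) (Y i) (U (Suc i))) [Suc j..<m]"
  have cyc: "linear_syzygy (X i) (Y i) (U k) \<in> (koszul_cycles (Suc d) 1 :: ('n, 'k) koszul set)" if "i < m" "k \<le> m" for i k
    using that U XY by (intro linear_syzygy_cycle) auto
  have xy: "set xs \<subseteq> koszul_cycles (Suc d) 1" "set ys \<subseteq> koszul_cycles (Suc d) 1"
    unfolding xs_def ys_def using j by (auto intro!: cyc simp del: One_nat_def)
  then have w: "wedge_list (xs @ ys) \<in> koszul_cycles (Suc d) (length (xs @ ys))"
    by (intro wedge_list_in_cycles) (simp del: One_nat_def)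
  have sub: "koszul_cycles (Suc d) 1 \<subseteq> (ext_power UNIV 1 :: ('n, 'k) koszul set)"
    by (auto simp: koszul_cycles_def intro: ext_power_UNIV)
  have front: "syzygy_product X Y m V = ext_scale ((-1) ^ j) (wedge
      (ext_scale (poly_monom (V 0)) (linear_syzygy (X j) (Y j) (V (Suc j)))) (wedge_list (xs @ ys)))"
    if "V (Suc j) \<in> monomials d" and V: "\<And>i. i \<noteq> j \<Longrightarrow> V (Suc i) = U (Suc i)" for V
  proof -
    have "map (\<lambda>i. linear_syzygy (X i) (Y i) (V (Suc i))) [0..<m] = xs @ linear_syzygy (X j) (Y j) (V (Suc j)) # ys"
      unfolding split_upt[OF j] xs_def ys_def by (simp add: V)
    moreover have "(linear_syzygy (X j) (Y j) (V (Suc j)) :: ('n, 'k) koszul) \<in> ext_power UNIV 1"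
      using linear_syzygy_cycle[of "X j" "Y j" "V (Suc j)" d] XY[OF j] that(1) sub by blast
    moreover have "length xs = j" by (simp add: xs_def)
    ultimately show ?thesis
      using xy sub
      by (simp add: syzygy_product_def wedge_list_front[OF subset_trans[OF xy(1) sub] _ subset_trans[OF xy(2) sub]]
          wedge_scale_left mult.commute)
  qed
  let ?L = "linear_syzygy (X j) (Y j) :: _ \<Rightarrow> ('n, 'k) koszul"
  define s :: "('n, 'k) koszul" where
    "s = wedge (gen (X j + U (Suc j))) (gen (Y j + U 0)) - wedge (gen (Y j + U (Suc j))) (gen (X j + U 0))"
  have gens: "gen (X j + U k) \<in> ext_power (monomials (Suc d)) 1" "gen (Y j + U k) \<in> ext_power (monomials (Suc d)) 1"
    if "k \<le> m" for k
    using monomials_add[of "X j" 1 "U k" d] monomials_add[of "Y j" 1 "U k" d] XY[OF j] U[OF that]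
    by (simp_all add: single_in_ext_power)
  have s: "s \<in> ext_power (monomials (Suc d)) (Suc 1)"
  proof -
    have "s \<in> ext_power (monomials (Suc d)) (1 + 1)"
      unfolding s_def by (intro ext.subspace_diff[OF subspace_ext_power] wedge_in_ext_power gens) (use j in auto)
    then show ?thesis by simp
  qed
  have "syzygy_product X Y m (U \<circ> transpose 0 (Suc j)) + syzygy_product X Y m U =
      ext_scale ((-1) ^ j) (wedge (ext_scale (poly_monom (U (Suc j))) (?L (U 0)) + ext_scale (poly_monom (U 0)) (?L (U (Suc j)))) (wedge_list (xs @ ys)))"
    using U j by (subst (1 2) front) (auto simp: transpose_def wedge_add_left ext.scale_right_distrib)
  also have "\<dots> = ext_scale ((-1) ^ j) (wedge (koszul_d poly_monom s) (wedge_list (xs @ ys)))"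
    by (simp only: linear_syzygy_exchange s_def)
  also have "\<dots> \<in> koszul_boundaries (Suc d) (1 + length (xs @ ys))"
    by (intro ext.subspace_scale[OF subspace_boundaries] boundary_wedge_cycle s w)
  also have "1 + length (xs @ ys) = m" using j by (simp add: xs_def ys_def)
  finally show ?thesis .
qed

text \<open>
  A transposition of two places other than \<open>0\<close> is a product of three transpositions that involve
  \<open>0\<close>, so it changes the sign three times.
\<close>

lemma syzygy_product_transpose:
  fixes U X Y :: "nat \<Rightarrow> 'n::{finite, linorder} monom"
  assumes U: "\<And>i. i \<le> m \<Longrightarrow> U i \<in> monomials d"
    and XY: "\<And>i. i < m \<Longrightarrow> X i \<in> monomials 1 \<and> Y i \<in> monomials 1"
    and ab: "a \<le> m" "b \<le> m" "a \<noteq> b"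
  shows "syzygy_product X Y m (U \<circ> transpose a b) + syzygy_product X Y m U
    \<in> (koszul_boundaries (Suc d) m :: ('n, 'k::field) koszul set)"
proof -
  let ?T = "\<lambda>V. syzygy_product X Y m V :: ('n, 'k) koszul"
  have star: "?T (V \<circ> transpose 0 k) + ?T V \<in> koszul_boundaries (Suc d) m"
    if "k \<le> m" "k \<noteq> 0" and V: "\<And>i. i \<le> m \<Longrightarrow> V i \<in> monomials d" for V k
    using syzygy_product_star_transpose[of m V d X Y "k - 1", OF V XY] that
    by (cases k) auto
  consider "a = 0" | "b = 0" | "a \<noteq> 0" "b \<noteq> 0" by blast
  then show ?thesis
  proof cases
    case 1
    then show ?thesis using star[of b U] U ab by simp
  next
    case 2
    then show ?thesis using star[of a U] U ab by (simp add: transpose_commute)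
  next
    case 3
    let ?a = "transpose 0 a" and ?b = "transpose 0 b"
    have "transpose a b = ?a \<circ> ?b \<circ> ?a"
      using 3 ab by (metis transpose_comp_triple transpose_commute)
    then have eq: "U \<circ> transpose a b = U \<circ> ?a \<circ> ?b \<circ> ?a" by (simp add: comp_assoc)
    have 1: "?T (U \<circ> ?a \<circ> ?b \<circ> ?a) + ?T (U \<circ> ?a \<circ> ?b) \<in> koszul_boundaries (Suc d) m"
      and 2: "?T (U \<circ> ?a \<circ> ?b) + ?T (U \<circ> ?a) \<in> koszul_boundaries (Suc d) m"
      and 3: "?T (U \<circ> ?a) + ?T U \<in> koszul_boundaries (Suc d) m"
      using 3 ab by (auto intro!: star U simp: transpose_def)
    \<comment> \<open>The intermediate terms cancel in \<open>1 - 2 + 3\<close>.\<close>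
    from ext.subspace_add[OF subspace_boundaries ext.subspace_diff[OF subspace_boundaries 1 2] 3]
    show ?thesis unfolding eq by (simp add: algebra_simps)
  qed
qed

lemma syzygy_product_permute:
  fixes U X Y :: "nat \<Rightarrow> 'n::{finite, linorder} monom"
  assumes U: "\<And>i. i \<le> m \<Longrightarrow> U i \<in> monomials d"
    and XY: "\<And>i. i < m \<Longrightarrow> X i \<in> monomials 1 \<and> Y i \<in> monomials 1"
    and "\<sigma> permutes {..m}"
  shows "syzygy_product X Y m U - ext_scale (of_int (sign \<sigma>)) (syzygy_product X Y m (U \<circ> \<sigma>))
    \<in> (koszul_boundaries (Suc d) m :: ('n, 'k::field) koszul set)"
  using finite_atMost assms(3)
proof (induction \<sigma> rule: permutes_rev_induct)
  case id
  show ?case using ext.subspace_0[OF subspace_boundaries] by simp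
next
  case (swap a b \<sigma>)
  let ?T = "\<lambda>V. syzygy_product X Y m V :: ('n, 'k) koszul"
  have "\<And>i. i \<le> m \<Longrightarrow> (U \<circ> \<sigma>) i \<in> monomials d"
    using U permutes_in_image[OF \<open>\<sigma> permutes {..m}\<close>] by simp
  then have "?T ((U \<circ> \<sigma>) \<circ> transpose a b) + ?T (U \<circ> \<sigma>) \<in> koszul_boundaries (Suc d) m"
    using swap by (intro syzygy_product_transpose[OF _ XY]) auto
  then have "(?T U - ext_scale (of_int (sign \<sigma>)) (?T (U \<circ> \<sigma>))) +
      ext_scale (of_int (sign \<sigma>)) (?T ((U \<circ> \<sigma>) \<circ> transpose a b) + ?T (U \<circ> \<sigma>)) \<in> koszul_boundaries (Suc d) m"
    by (rule ext.subspace_add[OF subspace_boundaries swap.IH ext.subspace_scale[OF subspace_boundaries]])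
  moreover have "sign (\<sigma> \<circ> transpose a b) = - sign \<sigma>"
    using swap permutation_permutes[of \<sigma>] by (subst sign_compose) (auto simp: permutation_swap_id sign_swap_id)
  ultimately show ?case
    by (simp add: comp_assoc ext.scale_right_distrib ext.scale_minus_left del: o_apply)
qed

text \<open>
  Each of the \<open>(Suc d + 1)!\<close> terms of the alternating sum is congruent to the syzygy product
  itself, and the alternating sum is a boundary.
\<close>

lemma factorial_syzygy_product_boundary:
  fixes U X Y :: "nat \<Rightarrow> 'n::{finite, linorder} monom"
  assumes U: "\<And>i. i \<le> Suc d \<Longrightarrow> U i \<in> monomials d"
    and XY: "\<And>i. i < Suc d \<Longrightarrow> X i \<in> monomials 1 \<and> Y i \<in> monomials 1"
  shows "ext_scale (of_nat (fact (Suc d + 1))) (syzygy_product X Y (Suc d) U)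
    \<in> (koszul_boundaries (Suc d) (Suc d) :: ('n, 'k::field) koszul set)"
proof -
  let ?T = "\<lambda>V. syzygy_product X Y (Suc d) V :: ('n, 'k) koszul"
  let ?P = "{\<sigma>. \<sigma> permutes {..Suc d}}"
  have sum: "(\<Sum>\<sigma>\<in>?P. ?T U - ext_scale (of_int (sign \<sigma>)) (?T (U \<circ> \<sigma>))) \<in> koszul_boundaries (Suc d) (Suc d)"
    by (rule ext.subspace_sum[OF subspace_boundaries], rule syzygy_product_permute) (use U XY in auto)
  have alt: "(\<Sum>\<sigma>\<in>?P. ext_scale (of_int (sign \<sigma>)) (?T (U \<circ> \<sigma>))) \<in> koszul_boundaries (Suc d) (Suc d)"
    using alternating_sum_boundary[of d U X Y 0] U XY
    by (simp add: syzygy_product_def less_Suc_eq_le del: upt_Suc)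
  have card: "card ?P = fact (Suc d + 1)" by (rule card_permutations) auto
  have const: "(\<Sum>\<sigma>\<in>A. x) = ext_scale (of_nat (card A)) x" for A :: "(nat \<Rightarrow> nat) set" and x :: "('n, 'k) koszul"
    by (induction A rule: infinite_finite_induct) (simp_all add: ext.scale_left_distrib)
  have "ext_scale (of_nat (fact (Suc d + 1))) (?T U) = (\<Sum>\<sigma>\<in>?P. ?T U - ext_scale (of_int (sign \<sigma>)) (?T (U \<circ> \<sigma>)))
      + (\<Sum>\<sigma>\<in>?P. ext_scale (of_int (sign \<sigma>)) (?T (U \<circ> \<sigma>)))"
    by (simp only: sum_subtractf const card diff_add_cancel)
  then show ?thesis using ext.subspace_add[OF subspace_boundaries sum alt] by (simp only:)
qed

definition linear_syzygies :: "nat \<Rightarrow> ('n::{finite, linorder}, 'k::field) koszul set" where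
  "linear_syzygies d = {linear_syzygy x y b | x y b. x \<in> monomials 1 \<and> y \<in> monomials 1 \<and> b \<in> monomials d}"

lemma factorial_linear_syzygies_boundary:
  fixes zs :: "('n::{finite, linorder}, 'k::field) koszul list"
  assumes "set zs \<subseteq> linear_syzygies d" "length zs = Suc d" "u \<in> monomials d"
  shows "ext_scale (of_nat (fact (Suc d + 1)) * poly_monom u) (wedge_list zs) \<in> koszul_boundaries (Suc d) (Suc d)"
proof -
  have "\<exists>x y b. zs ! i = linear_syzygy x y b \<and> x \<in> monomials 1 \<and> y \<in> monomials 1 \<and> b \<in> monomials d"
    if "i < Suc d" for i
  proof -
    have "zs ! i \<in> linear_syzygies d" using assms that nth_mem[of i zs] by auto
    then show ?thesis unfolding linear_syzygies_def by blast
  qed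
  then obtain X Y b where z: "\<And>i. i < Suc d \<Longrightarrow> zs ! i = linear_syzygy (X i) (Y i) (b i)"
    "\<And>i. i < Suc d \<Longrightarrow> X i \<in> monomials 1 \<and> Y i \<in> monomials 1" "\<And>i. i < Suc d \<Longrightarrow> b i \<in> monomials d"
    by metis
  have "zs = map (\<lambda>i. linear_syzygy (X i) (Y i) (case_nat u b (Suc i))) [0..<Suc d]"
    using assms(2) z(1) by (intro nth_equalityI) (auto simp del: upt_Suc)
  then have "ext_scale (poly_monom u) (wedge_list zs) = syzygy_product X Y (Suc d) (case_nat u b)"
    by (simp only: syzygy_product_def nat.case)
  moreover have "ext_scale (of_nat (fact (Suc d + 1))) (syzygy_product X Y (Suc d) (case_nat u b) :: ('n, 'k) koszul)
      \<in> koszul_boundaries (Suc d) (Suc d)"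
    using z assms(3) by (intro factorial_syzygy_product_boundary) (auto split: nat.split)
  ultimately show ?thesis by (metis ext.scale_scale)
qed

section \<open>The linear syzygies generate the one-cycles\<close>

lemma monomial_split:
  fixes u :: "'n monom"
  assumes "Poly_Mapping.lookup u i > 0"
  obtains b where "u = Poly_Mapping.single i 1 + b"
proof
  show "u = Poly_Mapping.single i 1 + (u - Poly_Mapping.single i 1)"
    using assms by (intro poly_mapping_eqI) (auto simp: lookup_add lookup_minus lookup_single when_def)
qed

lemma single_in_monomials: "Poly_Mapping.single i 1 \<in> monomials 1"
  by (simp add: monomials_def lookup_single when_def)

lemma monomials_cancel: "u + v \<in> monomials (c + d) \<Longrightarrow> u \<in> monomials c \<Longrightarrow> v \<in> monomials d"
  by (simp add: monomials_def lookup_add sum.distrib)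

text \<open>
  If \<open>u \<noteq> u'\<close>, the common degree forces \<open>u\<close> to exceed \<open>u'\<close> at some \<open>i\<close> and to be smaller at some
  \<open>j\<close>. Since \<open>u + v = u' + v'\<close>, the variable \<open>j\<close> divides \<open>v\<close>, so a multiple of one linear syzygy
  moves the variable \<open>i\<close> from \<open>u\<close> to \<open>v\<close> and \<open>j\<close> from \<open>v\<close> to \<open>u\<close>. This decreases the total excess
  of \<open>u\<close> over \<open>u'\<close>.
\<close>

lemma term_syzygy_in_span:
  fixes u v u' v' :: "'n::{finite, linorder} monom"
  assumes "u \<in> monomials (Suc d)" "u' \<in> monomials (Suc d)" "u + v = u' + v'"
  shows "ext_scale (poly_monom v) (gen u) - ext_scale (poly_monom v') (gen u')
    \<in> ext.span (linear_syzygies d :: ('n, 'k::field) koszul set)"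
  using assms
proof (induction "\<Sum>i\<in>UNIV. Poly_Mapping.lookup u i - Poly_Mapping.lookup u' i" arbitrary: u v rule: less_induct)
  case less
  have total: "(\<Sum>i\<in>UNIV. Poly_Mapping.lookup u i) = (\<Sum>i\<in>UNIV. Poly_Mapping.lookup u' i)"
    using less.prems by (simp add: monomials_def)
  show ?case
  proof (cases "u = u'")
    case True
    then show ?thesis using less.prems by (simp add: ext.span_zero)
  next
    case False
    have "\<exists>i. Poly_Mapping.lookup u' i < Poly_Mapping.lookup u i"
      using False sum_mono_inv[OF total] by (metis UNIV_I finite not_le poly_mapping_eqI)
    then obtain i where i: "Poly_Mapping.lookup u' i < Poly_Mapping.lookup u i" by blast
    have "\<exists>j. Poly_Mapping.lookup u j < Poly_Mapping.lookup u' j"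
      using False sum_mono_inv[OF total[symmetric]] by (metis UNIV_I finite not_le poly_mapping_eqI)
    then obtain j where j: "Poly_Mapping.lookup u j < Poly_Mapping.lookup u' j" by blast
    have "Poly_Mapping.lookup u j + Poly_Mapping.lookup v j = Poly_Mapping.lookup u' j + Poly_Mapping.lookup v' j"
      using less.prems by (metis lookup_add)
    with i j have pos: "Poly_Mapping.lookup u i > 0" "Poly_Mapping.lookup v j > 0" by linarith+
    let ?x = "Poly_Mapping.single i 1 :: 'n monom" and ?y = "Poly_Mapping.single j 1 :: 'n monom"
    from pos obtain b w where u: "u = ?x + b" and v: "v = ?y + w" by (meson monomial_split)
    have b: "b \<in> monomials d"
      using monomials_cancel[of ?x b 1 d] less.prems single_in_monomials[of i] by (simp add: u)
    have "ext_scale (poly_monom (?x + w)) (gen (?y + b)) - ext_scale (poly_monom v') (gen u')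
        \<in> ext.span (linear_syzygies d :: ('n, 'k) koszul set)"
    proof (rule less.hyps)
      have "i \<noteq> j" using i j by auto
      show "(\<Sum>k\<in>UNIV. Poly_Mapping.lookup (?y + b) k - Poly_Mapping.lookup u' k)
          < (\<Sum>k\<in>UNIV. Poly_Mapping.lookup u k - Poly_Mapping.lookup u' k)"
      proof (rule sum_strict_mono_ex1)
        show "\<forall>k\<in>UNIV. Poly_Mapping.lookup (?y + b) k - Poly_Mapping.lookup u' k
            \<le> Poly_Mapping.lookup u k - Poly_Mapping.lookup u' k"
          using j by (auto simp: u lookup_add lookup_single when_def)
        show "\<exists>k\<in>UNIV. Poly_Mapping.lookup (?y + b) k - Poly_Mapping.lookup u' k
            < Poly_Mapping.lookup u k - Poly_Mapping.lookup u' k"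
          using i \<open>i \<noteq> j\<close> by (intro bexI[of _ i]) (auto simp: u lookup_add lookup_single when_def)
      qed simp
      show "?y + b \<in> monomials (Suc d)" using monomials_add[OF single_in_monomials b] by simp
      show "?y + b + (?x + w) = u' + v'" using less.prems(3) by (simp add: u v ac_simps)
    qed (use less.prems in simp)
    moreover have "ext_scale (poly_monom w) (linear_syzygy ?y ?x b) \<in> ext.span (linear_syzygies d :: ('n, 'k) koszul set)"
      unfolding linear_syzygies_def
      by (intro ext.span_scale ext.span_base) (use b single_in_monomials in blast)
    ultimately have "ext_scale (poly_monom w) (linear_syzygy ?y ?x b) +
       (ext_scale (poly_monom (?x + w)) (gen (?y + b)) - ext_scale (poly_monom v') (gen u'))
       \<in> ext.span (linear_syzygies d :: ('n, 'k) koszul set)"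
      by (metis ext.span_add)
    moreover have "ext_scale (poly_monom w) (linear_syzygy ?y ?x b) =
        ext_scale (poly_monom v) (gen u) - (ext_scale (poly_monom (?x + w)) (gen (?y + b)) :: ('n, 'k) koszul)"
      unfolding u v linear_syzygy_def poly_monom_add
      by (simp only: ext.scale_right_diff_distrib ext.scale_scale mult.commute)
    ultimately show ?thesis by simp
  qed
qed

text \<open>
  Modulo the linear syzygies, the class of \<open>v [u]\<close> depends only on the monomial \<open>u + v\<close>, by
  \<open>term_syzygy_in_span\<close>. Choosing a representative \<open>N w\<close> for each product \<open>w\<close> and extending
  linearly over the field to \<open>L\<close>, every element \<open>z\<close> of degree one is congruent to \<open>L\<close> applied to the
  polynomial \<open>\<partial> z\<close>. For a cycle this polynomial is \<open>0\<close>.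
\<close>

lemma cycles1_spanned_by_linear_syzygies:
  "koszul_cycles (Suc d) 1 \<subseteq> ext.span (linear_syzygies d :: ('n::{finite, linorder}, 'k::field) koszul set)"
proof
  fix z :: "('n, 'k) koszul" assume z: "z \<in> koszul_cycles (Suc d) 1"
  let ?M = "monomials (Suc d) :: 'n monom set"
  let ?const = "\<lambda>k. Poly_Mapping.single 0 k :: ('n, 'k) mpoly"
  have "\<exists>p. (\<exists>u v. u \<in> ?M \<and> w = u + v) \<longrightarrow> fst p \<in> ?M \<and> w = fst p + snd p" for w
    by (metis fst_conv snd_conv)
  then obtain p where p: "\<And>w u v. u \<in> ?M \<Longrightarrow> w = u + v \<Longrightarrow> fst (p w) \<in> ?M \<and> w = fst (p w) + snd (p w)"
    by metis
  \<comment> \<open>\<open>p w\<close> is a chosen factorization of the monomial \<open>w\<close> with first factor of degree \<open>Suc d\<close>.\<close>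
  define N :: "'n monom \<Rightarrow> ('n, 'k) koszul" where "N w = ext_scale (poly_monom (snd (p w))) (gen (fst (p w)))" for w
  define L :: "('n, 'k) mpoly \<Rightarrow> ('n, 'k) koszul" where
    "L q = (\<Sum>w\<in>Poly_Mapping.keys q. ext_scale (?const (Poly_Mapping.lookup q w)) (N w))" for q
  have L_superset: "L q = (\<Sum>w\<in>T. ext_scale (?const (Poly_Mapping.lookup q w)) (N w))"
    if "finite T" "Poly_Mapping.keys q \<subseteq> T" for q T
    unfolding L_def using that by (intro sum.mono_neutral_left) (auto simp: in_keys_iff)
  have L_add: "L (q + r) = L q + L r" for q r
    using keys_add[of q r]
    by (subst (1 2 3) L_superset[of "Poly_Mapping.keys q \<union> Poly_Mapping.keys r"])
       (auto simp: lookup_add single_add ext.scale_left_distrib sum.distrib)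
  have L_single: "L (Poly_Mapping.single w k) = ext_scale (?const k) (N w)" for w k
    by (subst L_superset[of "{w}"]) auto
  have L_0: "L 0 = 0" by (simp add: L_def)
  let ?S = "ext.span (linear_syzygies d :: ('n, 'k) koszul set)"
  have gen: "ext_scale q (gen u) - L (q * poly_monom u) \<in> ?S" if u: "u \<in> ?M" for u q
  proof (induction q rule: update_induct)
    case const
    then show ?case by (simp add: L_0 ext.span_zero)
  next
    case (update f v k)
    have upd: "Poly_Mapping.update v k f = Poly_Mapping.single v k + f"
      using update(1) by (intro poly_mapping_eqI) (auto simp: lookup_update lookup_add lookup_single when_def in_keys_iff)
    have sv: "Poly_Mapping.single v k = ?const k * poly_monom v" by (simp add: poly_monom_def mult_single)
    have "ext_scale (poly_monom v) (gen u) - N (u + v) \<in> ?S"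
      unfolding N_def using p[OF u refl, of v] by (intro term_syzygy_in_span u) auto
    then have "ext_scale (?const k) (ext_scale (poly_monom v) (gen u) - N (u + v)) \<in> ?S"
      by (rule ext.span_scale)
    moreover have "ext_scale (?const k) (ext_scale (poly_monom v) (gen u) - N (u + v)) =
        ext_scale (Poly_Mapping.single v k) (gen u) - L (Poly_Mapping.single v k * poly_monom u)"
    proof -
      have "L (Poly_Mapping.single v k * poly_monom u) = ext_scale (?const k) (N (u + v))"
        by (simp add: poly_monom_def mult_single L_single add.commute)
      then show ?thesis by (simp only: ext.scale_right_diff_distrib ext.scale_scale sv)
    qed
    ultimately have "ext_scale (Poly_Mapping.single v k) (gen u) - L (Poly_Mapping.single v k * poly_monom u) +
        (ext_scale f (gen u) - L (f * poly_monom u)) \<in> ?S"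
      using update.IH by (metis ext.span_add)
    then show ?case
      unfolding upd ext.scale_left_distrib distrib_right L_add by (simp add: algebra_simps del: ext_scale_single)
  qed
  have "z \<in> ext.span (gen ` ?M)" using z ext_power_1_span by (auto simp: koszul_cycles_def)
  then have "z - L (Poly_Mapping.lookup (koszul_d poly_monom z) {}) \<in> ?S"
  proof (induction rule: ext.span_induct_alt)
    case base
    then show ?case by (simp add: L_0 ext.span_zero)
  next
    case (step q x y)
    then obtain u where u: "u \<in> ?M" and x: "x = gen u" by blast
    have "Poly_Mapping.lookup (koszul_d poly_monom (ext_scale q x + y)) {} =
        q * poly_monom u + Poly_Mapping.lookup (koszul_d poly_monom y) {}"
      by (simp add: x koszul_d_add koszul_d_scale koszul_d_generator lookup_add lookup_single del: ext_scale_single)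
    then have "ext_scale q x + y - L (Poly_Mapping.lookup (koszul_d poly_monom (ext_scale q x + y)) {}) =
        (ext_scale q (gen u) - L (q * poly_monom u)) + (y - L (Poly_Mapping.lookup (koszul_d poly_monom y) {}))"
      by (simp only: x L_add) (simp add: algebra_simps)
    then show ?case using ext.span_add[OF gen[OF u, of q] step(2)] by (simp only:)
  qed
  moreover have "koszul_d poly_monom z = 0" using z by (simp add: koszul_cycles_def)
  ultimately show "z \<in> ?S" by (simp add: L_0)
qed

section \<open>From generators to submodules\<close>

lemma poly_var_eq: "poly_var i = poly_monom (Poly_Mapping.single i 1)"
  by (simp add: poly_var_def poly_monom_def)

lemma ideal_pow_max_ideal_subset:
  "ideal_pow max_ideal k \<subseteq> ideal_gen (poly_monom ` monomials k :: ('n::finite, 'k::field) mpoly set)"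
proof (induction k)
  interpret R: module "(*) :: ('n, 'k) mpoly \<Rightarrow> _" by (rule module_mult)
  case 0
  have "(1 :: ('n, 'k) mpoly) \<in> poly_monom ` monomials 0"
    by (rule image_eqI[of _ _ 0]) (simp_all add: poly_monom_def monomials_def)
  then have "r * 1 \<in> ideal_gen (poly_monom ` monomials 0)" for r :: "('n, 'k) mpoly"
    by (intro R.span_scale R.span_base)
  then show ?case by auto
next
  interpret R: module "(*) :: ('n, 'k) mpoly \<Rightarrow> _" by (rule module_mult)
  case (Suc k)
  let ?S = "ideal_gen (poly_monom ` monomials (Suc k) :: ('n, 'k) mpoly set)"
  have var: "poly_var i * b \<in> ?S" if "b \<in> ideal_gen (poly_monom ` monomials k)" for i b
    using that
  proof (induction rule: R.span_induct_alt)
    case base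
    then show ?case by (simp add: R.span_zero)
  next
    case (step r x y)
    then obtain u where "u \<in> monomials k" "x = poly_monom u" by blast
    then have "poly_var i * x \<in> poly_monom ` monomials (Suc k)"
      using monomials_add[OF single_in_monomials, of u k i] by (simp add: poly_var_eq flip: poly_monom_add)
    then have "r * (poly_var i * x) \<in> ?S" by (intro R.span_scale R.span_base)
    then have "r * (poly_var i * x) + poly_var i * y \<in> ?S" using step.IH by (intro R.span_add)
    then show ?case by (simp only: distrib_left mult.left_commute)
  qed
  have "a * b \<in> ?S" if "a \<in> max_ideal" and b: "b \<in> ideal_gen (poly_monom ` monomials k)" for a b
    using that(1) unfolding max_ideal_def
  proof (induction rule: R.span_induct_alt)
    case base
    then show ?case by (simp add: R.span_zero)
  next
    case (step r x y)
    then obtain i where "x = poly_var i" by blast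
    then have "r * (x * b) \<in> ?S" using R.span_scale[OF var[OF b]] by (simp only:)
    then have "r * (x * b) + y * b \<in> ?S" using step.IH by (intro R.span_add)
    then show ?case by (simp only: distrib_right mult.assoc)
  qed
  then have "{a * b | a b. a \<in> max_ideal \<and> b \<in> ideal_pow max_ideal k} \<subseteq> ?S" using Suc by blast
  then show ?case unfolding ideal_pow.simps by (rule R.span_minimal[OF _ R.subspace_span])
qed

text \<open>
  Multilinearity allows the factors to be passed from a generating set to its span. They are
  passed one at a time: in the induction, the factors \<open>xs\<close> are generators and the factors \<open>ys\<close>
  are arbitrary.
\<close>

lemma wedge_list_span:
  assumes "ext.subspace N" and "\<And>zs. set zs \<subseteq> G \<Longrightarrow> length zs = t \<Longrightarrow> ext_scale r (wedge_list zs) \<in> N"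
    and "set zs \<subseteq> ext.span G" "length zs = t"
  shows "ext_scale r (wedge_list zs) \<in> N"
proof -
  have "ext_scale r (wedge_list (xs @ ys)) \<in> N"
    if "set xs \<subseteq> G" "set ys \<subseteq> ext.span G" "length (xs @ ys) = t" for xs ys
    using that
  proof (induction ys arbitrary: xs)
    case Nil
    then show ?case using assms(2) by simp
  next
    case (Cons a ys)
    from Cons.prems(2) have "a \<in> ext.span G" by simp
    then show ?case
    proof (induction rule: ext.span_induct_alt)
      case base
      then show ?case using ext.subspace_0[OF assms(1)] by (simp add: wedge_list_linear)
    next
      case (step q x y)
      have "ext_scale r (wedge_list ((xs @ [x]) @ ys)) \<in> N"
        using Cons.prems step by (intro Cons.IH) auto
      then have "ext_scale r (wedge_list (xs @ x # ys)) \<in> N" by simp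
      then have "ext_scale q (ext_scale r (wedge_list (xs @ x # ys))) \<in> N"
        by (rule ext.subspace_scale[OF assms(1)])
      from ext.subspace_add[OF assms(1) this step.IH]
      show ?case by (simp add: wedge_list_linear ext.scale_right_distrib mult.commute)
    qed
  qed
  from this[of "[]" zs] assms show ?thesis by simp
qed

theorem theorem3p6:
  fixes c :: nat
  assumes "c \<ge> 1"
  shows "ext_scale (of_nat (fact (c + 1))) `
           ideal_smult (ideal_pow max_ideal (c - 1)) (cycles1_power c c)
         \<subseteq> (koszul_boundaries c c :: ('n::{finite, linorder}, 'k::field) koszul set)"
proof -
  obtain d where c: "c = Suc d" using assms by (cases c) auto
  let ?B = "koszul_boundaries c c :: ('n, 'k) koszul set"
  let ?F = "of_nat (fact (c + 1)) :: ('n, 'k) mpoly"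
  note B = subspace_boundaries[of c c]
  have monom: "ext_scale (?F * poly_monom u) (wedge_list zs) \<in> ?B"
    if "u \<in> monomials d" "set zs \<subseteq> koszul_cycles c 1" "length zs = c" for u zs
  proof (rule wedge_list_span[OF B])
    show "ext_scale (?F * poly_monom u) (wedge_list ys) \<in> ?B"
      if "set ys \<subseteq> linear_syzygies d" "length ys = Suc d" for ys
      using factorial_linear_syzygies_boundary[OF that \<open>u \<in> monomials d\<close>] unfolding c .
    show "set zs \<subseteq> ext.span (linear_syzygies d)" "length zs = Suc d"
      using that cycles1_spanned_by_linear_syzygies[of d] unfolding c by blast+
  qed
  have ideal: "ext_scale (?F * a) (wedge_list zs) \<in> ?B"
    if "a \<in> ideal_pow max_ideal d" and zs: "set zs \<subseteq> koszul_cycles c 1" "length zs = c" for a zs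
  proof -
    interpret R: module "(*) :: ('n, 'k) mpoly \<Rightarrow> _" by (rule module_mult)
    have "a \<in> ideal_gen (poly_monom ` monomials d)" using that(1) ideal_pow_max_ideal_subset by blast
    then show ?thesis
    proof (induction rule: R.span_induct_alt)
      case base
      then show ?case using ext.subspace_0[OF B] by simp
    next
      case (step r x y)
      then obtain u where "u \<in> monomials d" "x = poly_monom u" by blast
      then have "ext_scale (?F * x) (wedge_list zs) \<in> ?B"
        using monom[OF _ zs] by (simp only:)
      then have "ext_scale r (ext_scale (?F * x) (wedge_list zs)) \<in> ?B"
        by (rule ext.subspace_scale[OF B])
      from ext.subspace_add[OF B this step.IH]
      show ?case by (simp only: ext.scale_left_distrib distrib_left ext.scale_scale mult.left_commute)
    qed
  qed
  have prod: "ext_scale ?F (ext_scale a w) \<in> ?B"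
    if "a \<in> ideal_pow max_ideal d" "w \<in> cycles1_power c c" for a w
    using that(2) unfolding cycles1_power_def
  proof (induction rule: ext.span_induct_alt)
    case base
    then show ?case using ext.subspace_0[OF B] by simp
  next
    case (step r x y)
    then obtain zs where "x = wedge_list zs" "length zs = c" "set zs \<subseteq> koszul_cycles c 1" by blast
    then have "ext_scale r (ext_scale (?F * a) x) \<in> ?B"
      using ext.subspace_scale[OF B ideal[OF that(1)]] by (simp only:)
    from ext.subspace_add[OF B this step.IH]
    show ?case by (simp only: ext.scale_right_distrib ext.scale_scale mult_ac)
  qed
  have "ext_scale ?F x \<in> ?B" if "x \<in> ideal_smult (ideal_pow max_ideal d) (cycles1_power c c)" for x
    using that unfolding ideal_smult_def
  proof (induction rule: ext.span_induct_alt)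
    case base
    then show ?case using ext.subspace_0[OF B] by simp
  next
    case (step r x y)
    then obtain a w where "x = ext_scale a w" "a \<in> ideal_pow max_ideal d" "w \<in> cycles1_power c c" by blast
    then have "ext_scale r (ext_scale ?F x) \<in> ?B"
      using ext.subspace_scale[OF B prod] by (simp only:)
    from ext.subspace_add[OF B this step.IH]
    show ?case by (simp only: ext.scale_right_distrib ext.scale_scale mult.commute)
  qed
  then show ?thesis unfolding c diff_Suc_1 by blast
qed

end
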